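(* Let $M$ be a compact manifold with an action by $C^k$ diffeomorphisms of a countable group $\Gamma$ preserving a $k$-th order geometric structure $\omega$. Let $N$ be a manifold with an action of a group $\Gamma'$ by $C^k$ diffeomorphisms such that $(N,\Gamma')$ is $C^k$ orbit equivalent to $(M,\Gamma)$. Then the $\Gamma'$-action on $N$ preserves a geometric structure of the same type as $\omega$.
   Context: Manifolds are smooth. $(N,\Gamma')$ and $(M,\Gamma)$ are $C^k$ orbit equivalent if there is a $C^k$ diffeomorphism $f:N\to M$ mapping the orbit relation of $\Gamma'$ to the orbit relation of $\Gamma$ ($x,y$ lie in the same $\Gamma'$-orbit if and only if $f(x),f(y)$ lie in the same $\Gamma$-orbit). For an $n$-dimensional manifold $M$, let $D^k$ be the group of $k$-jets at $0$ of diffeomorphisms of $\mathbb{R}^n$ fixing the origin, and let $P^k(M)$ be the $k$-th order frame bundle of $M$, a principal $D^k$-bundle. A geometric structure of order $k$ on $M$ consists of a manifold $V$, an action of $D^k$ on $V$, and a continuous $D^k$-equivariant map $\omega:P^k(M)\to V$; it is denoted by $\omega$. Two geometric structures are of the same type if their orders $k$ are the same and their manifolds $V$ are isomorphic as $D^k$-spaces. A $C^k$ diffeomorphism $g$ of $M$ preserves $\omega$ if $\omega\circ g^{k}=\omega$, where $g^{k}:P^k(M)\to P^k(M)$ is the induced map; a group action by $C^k$ diffeomorphisms preserves $\omega$ if every group element does. *)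

theory Defs
  imports "HOL-Analysis.Analysis" "HOL-Algebra.Group_Action"
begin

section \<open>Differentiability of class \<open>C\<^sup>k\<close>\<close>

text \<open>
  A type of the following class plays the role of \<open>\<real>\<^sup>n\<close>. In contrast to
  \<^class>\<open>euclidean_space\<close>, the trivial space is allowed, so that manifolds of dimension 0
  are covered (for example a finite set on which a jet group acts).
\<close>

class finite_dim_inner = real_inner +
  assumes finite_dim: "\<exists>B. finite B \<and> (\<forall>x. \<exists>c. x = (\<Sum>b\<in>B. c b *\<^sub>R b))"

instance euclidean_space \<subseteq> finite_dim_inner
  by standard (metis finite_Basis euclidean_representation)

text \<open>Meaningful for open \<open>S\<close>.\<close>

primrec Ck_on :: "nat \<Rightarrow> 'a::finite_dim_inner set \<Rightarrow> ('a \<Rightarrow> 'b::finite_dim_inner) \<Rightarrow> bool" where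
  "Ck_on 0 S f \<longleftrightarrow> continuous_on S f"
| "Ck_on (Suc k) S f \<longleftrightarrow> (\<forall>x\<in>S. f differentiable (at x)) \<and>
     (\<forall>v. Ck_on k S (\<lambda>x. frechet_derivative f (at x) v))"

definition smooth_on :: "'a::finite_dim_inner set \<Rightarrow> ('a \<Rightarrow> 'b::finite_dim_inner) \<Rightarrow> bool" where
  "smooth_on S f \<longleftrightarrow> (\<forall>k. Ck_on k S f)"

primrec iter_deriv ::
  "'a::finite_dim_inner list \<Rightarrow> ('a \<Rightarrow> 'b::finite_dim_inner) \<Rightarrow> 'a \<Rightarrow> 'b" where
  "iter_deriv [] f = f"
| "iter_deriv (v # vs) f = (\<lambda>x. frechet_derivative (iter_deriv vs f) (at x) v)"

text \<open>
  The \<open>k\<close>-jet at 0 of a map between vector spaces, recorded as the family of all its derivatives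
  at 0 of order at most \<open>k\<close>.
\<close>

definition jet0 ::
  "nat \<Rightarrow> ('a::finite_dim_inner \<Rightarrow> 'b::finite_dim_inner) \<Rightarrow> ('a list \<Rightarrow> 'b)" where
  "jet0 k f = (\<lambda>vs. if length vs \<le> k then iter_deriv vs f 0 else 0)"


section \<open>Smooth manifolds\<close>

text \<open>
  A chart is given as a pair \<open>(U, \<phi>)\<close>; only the values of \<open>\<phi>\<close> on \<open>U\<close> matter. The atlas need not be
  maximal.
\<close>

record ('m, 'e) mfd =
  mtop :: "'m topology"
  atlas :: "('m set \<times> ('m \<Rightarrow> 'e)) set"

definition chart_on :: "'m topology \<Rightarrow> 'm set \<Rightarrow> ('m \<Rightarrow> 'e::finite_dim_inner) \<Rightarrow> bool" where
  "chart_on X U \<phi> \<longleftrightarrow> openin X U \<and> open (\<phi> ` U) \<and>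
     homeomorphic_map (subtopology X U) (top_of_set (\<phi> ` U)) \<phi>"

definition smooth_manifold :: "('m, 'e::finite_dim_inner) mfd \<Rightarrow> bool" where
  "smooth_manifold M \<longleftrightarrow>
     Hausdorff_space (mtop M) \<and> second_countable (mtop M) \<and>
     (\<forall>(U, \<phi>)\<in>atlas M. chart_on (mtop M) U \<phi>) \<and>
     (\<Union>(U, \<phi>)\<in>atlas M. U) = topspace (mtop M) \<and>
     (\<forall>(U, \<phi>)\<in>atlas M. \<forall>(W, \<psi>)\<in>atlas M.
        smooth_on (\<phi> ` (U \<inter> W)) (\<psi> \<circ> inv_into U \<phi>))"

definition Ck_map ::
  "nat \<Rightarrow> ('m, 'e::finite_dim_inner) mfd \<Rightarrow> ('n, 'f::finite_dim_inner) mfd \<Rightarrow> ('m \<Rightarrow> 'n) \<Rightarrow> bool" where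
  "Ck_map k M N f \<longleftrightarrow> continuous_map (mtop M) (mtop N) f \<and>
     (\<forall>(U, \<phi>)\<in>atlas M. \<forall>(W, \<psi>)\<in>atlas N.
        Ck_on k (\<phi> ` (U \<inter> f -` W)) (\<psi> \<circ> f \<circ> inv_into U \<phi>))"

definition Ck_diffeo ::
  "nat \<Rightarrow> ('m, 'e::finite_dim_inner) mfd \<Rightarrow> ('n, 'f::finite_dim_inner) mfd \<Rightarrow> ('m \<Rightarrow> 'n) \<Rightarrow> bool" where
  "Ck_diffeo k M N f \<longleftrightarrow> bij_betw f (topspace (mtop M)) (topspace (mtop N)) \<and>
     Ck_map k M N f \<and> Ck_map k N M (inv_into (topspace (mtop M)) f)"

definition smooth_diffeo ::
  "('m, 'e::finite_dim_inner) mfd \<Rightarrow> ('n, 'f::finite_dim_inner) mfd \<Rightarrow> ('m \<Rightarrow> 'n) \<Rightarrow> bool" where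
  "smooth_diffeo M N f \<longleftrightarrow> (\<forall>k. Ck_diffeo k M N f)"

definition euclid :: "'e::finite_dim_inner set \<Rightarrow> ('e, 'e) mfd" where
  "euclid S = \<lparr>mtop = top_of_set S, atlas = {(S, \<lambda>x. x)}\<rparr>"

definition open_submfd :: "('m, 'e) mfd \<Rightarrow> 'm set \<Rightarrow> ('m, 'e) mfd" where
  "open_submfd M W = \<lparr>mtop = subtopology (mtop M) W, atlas = (\<lambda>(U, \<phi>). (U \<inter> W, \<phi>)) ` atlas M\<rparr>"


section \<open>Group actions by \<open>C\<^sup>k\<close> diffeomorphisms and orbit equivalence\<close>

definition Ck_action ::
  "nat \<Rightarrow> ('m, 'e::finite_dim_inner) mfd \<Rightarrow> ('g, 'x) monoid_scheme \<Rightarrow> ('g \<Rightarrow> 'm \<Rightarrow> 'm) \<Rightarrow> bool" where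
  "Ck_action k M \<Gamma> \<alpha> \<longleftrightarrow> group_action \<Gamma> (topspace (mtop M)) \<alpha> \<and>
     (\<forall>\<gamma>\<in>carrier \<Gamma>. Ck_diffeo k M M (\<alpha> \<gamma>))"

definition Ck_orbit_equivalent ::
  "nat \<Rightarrow> ('n, 'f::finite_dim_inner) mfd \<Rightarrow> ('h, 'y) monoid_scheme \<Rightarrow> ('h \<Rightarrow> 'n \<Rightarrow> 'n) \<Rightarrow>
   ('m, 'e::finite_dim_inner) mfd \<Rightarrow> ('g, 'x) monoid_scheme \<Rightarrow> ('g \<Rightarrow> 'm \<Rightarrow> 'm) \<Rightarrow> bool" where
  "Ck_orbit_equivalent k N \<Gamma>' \<alpha>' M \<Gamma> \<alpha> \<longleftrightarrow>
     (\<exists>f. Ck_diffeo k N M f \<and>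
       (\<forall>x\<in>topspace (mtop N). \<forall>y\<in>topspace (mtop N).
          y \<in> orbit \<Gamma>' \<alpha>' x \<longleftrightarrow> f y \<in> orbit \<Gamma> \<alpha> (f x)))"


section \<open>The jet group \<open>D\<^sup>k\<close>\<close>

definition origin_diffeos :: "('e::finite_dim_inner \<Rightarrow> 'e) set" where
  "origin_diffeos = {a. smooth_diffeo (euclid UNIV) (euclid UNIV) a \<and> a 0 = 0}"

text \<open>The product of two jets is the jet of the composite of any representatives.\<close>

definition jet_group :: "nat \<Rightarrow> ('e::finite_dim_inner list \<Rightarrow> 'e) monoid" where
  "jet_group k =
     \<lparr>carrier = jet0 k ` origin_diffeos,
      mult = (\<lambda>p q. jet0 k (inv_into origin_diffeos (jet0 k) p \<circ> inv_into origin_diffeos (jet0 k) q)),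
      one = jet0 k id\<rparr>"

text \<open>
  The derivatives of order \<open>i\<close> at 0 are \<open>i\<close>-linear in the directions, so on jets the product topology
  of the type \<^typ>\<open>'e list \<Rightarrow> 'e\<close> is the usual topology of the finite-dimensional space of
  \<open>k\<close>-jets.
\<close>

definition jet_group_topology :: "nat \<Rightarrow> ('e::finite_dim_inner list \<Rightarrow> 'e) topology" where
  "jet_group_topology k = top_of_set (carrier (jet_group k))"

text \<open>
  \<open>V\<close> is a manifold on which the Lie group \<open>D\<^sup>k\<close> acts continuously by diffeomorphisms. By a theorem
  of Bochner and Montgomery such an action is automatically jointly smooth.
\<close>

definition jet_group_space ::
  "nat \<Rightarrow> ('v, 'f::finite_dim_inner) mfd \<Rightarrow> (('e::finite_dim_inner list \<Rightarrow> 'e) \<Rightarrow> 'v \<Rightarrow> 'v) \<Rightarrow> bool" where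
  "jet_group_space k V \<rho> \<longleftrightarrow> smooth_manifold V \<and>
     group_action (jet_group k) (topspace (mtop V)) \<rho> \<and>
     (\<forall>j\<in>carrier (jet_group k). smooth_diffeo V V (\<rho> j)) \<and>
     continuous_map (prod_topology (jet_group_topology k) (mtop V)) (mtop V) (\<lambda>(j, v). \<rho> j v)"


section \<open>The frame bundle of order \<open>k\<close>\<close>

text \<open>
  A frame of order \<open>k\<close> on \<open>M\<close> is the \<open>k\<close>-jet at 0 of a diffeomorphism from a neighbourhood of 0
  in \<open>\<real>\<^sup>n\<close> onto an open subset of \<open>M\<close>, represented as the set of all such local diffeomorphisms with
  this jet. Representatives are allowed to be merely \<open>C\<^sup>k\<close>: each of their jets is also the jet of a
  smooth one, and \<open>C\<^sup>k\<close> diffeomorphisms of \<open>M\<close> then act by composition with representatives.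
\<close>

definition frame_germ ::
  "nat \<Rightarrow> ('m, 'e::finite_dim_inner) mfd \<Rightarrow> ('e \<Rightarrow> 'm) \<Rightarrow> bool" where
  "frame_germ k M u \<longleftrightarrow>
     (\<exists>S W. open S \<and> 0 \<in> S \<and> openin (mtop M) W \<and> Ck_diffeo k (euclid S) (open_submfd M W) u)"

definition frame_jet ::
  "nat \<Rightarrow> ('m, 'e::finite_dim_inner) mfd \<Rightarrow> ('e \<Rightarrow> 'm) \<Rightarrow> ('e \<Rightarrow> 'm) set" where
  "frame_jet k M u =
     {w. frame_germ k M w \<and> w 0 = u 0 \<and>
         (\<forall>(U, \<phi>)\<in>atlas M. u 0 \<in> U \<longrightarrow> jet0 k (\<phi> \<circ> w) = jet0 k (\<phi> \<circ> u))}"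

definition frame_bundle ::
  "nat \<Rightarrow> ('m, 'e::finite_dim_inner) mfd \<Rightarrow> ('e \<Rightarrow> 'm) set set" where
  "frame_bundle k M = {frame_jet k M u | u. frame_germ k M u}"

text \<open>
  A chart \<open>(U, \<phi>)\<close> of \<open>M\<close> identifies the frames over \<open>U\<close> with jets of maps between vector spaces;
  the frame bundle has the coarsest topology making the sets of frames over the charts open and
  these identifications continuous.
\<close>

definition frame_topology ::
  "nat \<Rightarrow> ('m, 'e::finite_dim_inner) mfd \<Rightarrow> ('e \<Rightarrow> 'm) set topology" where
  "frame_topology k M = topology_generated_by
     {{frame_jet k M u | u. frame_germ k M u \<and> u 0 \<in> U \<and> jet0 k (\<phi> \<circ> u) \<in> Q} | U \<phi> Q.
        (U, \<phi>) \<in> atlas M \<and> open Q}"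

text \<open>
  The induced map \<open>g\<^sup>k\<close> on frames; the union is over representatives of \<open>p\<close>, all of which give the
  same frame.
\<close>

definition frame_map ::
  "nat \<Rightarrow> ('n, 'e::finite_dim_inner) mfd \<Rightarrow> ('m \<Rightarrow> 'n) \<Rightarrow> ('e \<Rightarrow> 'm) set \<Rightarrow> ('e \<Rightarrow> 'n) set" where
  "frame_map k N g p = (\<Union>u\<in>p. frame_jet k N (g \<circ> u))"


section \<open>Geometric structures\<close>

record ('m, 'e, 'v, 'f) geom_structure =
  gs_order :: nat
  gs_space :: "('v, 'f) mfd"
  gs_act :: "('e list \<Rightarrow> 'e) \<Rightarrow> 'v \<Rightarrow> 'v"
  gs_map :: "('e \<Rightarrow> 'm) set \<Rightarrow> 'v"

text \<open>
  The jet group acts on the frame bundle on the right by precomposition and on \<open>V\<close> on the left, so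
  equivariance reads \<open>\<omega>(p\<cdot>j) = j\<^sup>-\<^sup>1\<cdot>\<omega>(p)\<close>.
\<close>

definition geometric_structure ::
  "('m, 'e::finite_dim_inner) mfd \<Rightarrow> ('m, 'e, 'v, 'f::finite_dim_inner) geom_structure \<Rightarrow> bool" where
  "geometric_structure M \<omega> \<longleftrightarrow>
     (let k = gs_order \<omega> in
       jet_group_space k (gs_space \<omega>) (gs_act \<omega>) \<and>
       continuous_map (frame_topology k M) (mtop (gs_space \<omega>)) (gs_map \<omega>) \<and>
       (\<forall>u a. frame_germ k M u \<and> a \<in> origin_diffeos \<longrightarrow>
          gs_map \<omega> (frame_jet k M (u \<circ> a)) =
          gs_act \<omega> (inv\<^bsub>jet_group k\<^esub> (jet0 k a)) (gs_map \<omega> (frame_jet k M u))))"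

definition same_type ::
  "('m, 'e::finite_dim_inner, 'v, 'f::finite_dim_inner) geom_structure \<Rightarrow>
   ('n, 'e, 'w, 'h::finite_dim_inner) geom_structure \<Rightarrow> bool" where
  "same_type \<omega> \<omega>' \<longleftrightarrow> gs_order \<omega> = gs_order \<omega>' \<and>
     (\<exists>F. smooth_diffeo (gs_space \<omega>) (gs_space \<omega>') F \<and>
       (\<forall>j\<in>carrier (jet_group (gs_order \<omega>)). \<forall>v\<in>topspace (mtop (gs_space \<omega>)).
          F (gs_act \<omega> j v) = gs_act \<omega>' j (F v)))"

definition preserves ::
  "('m, 'e::finite_dim_inner) mfd \<Rightarrow> ('m, 'e, 'v, 'f) geom_structure \<Rightarrow> ('m \<Rightarrow> 'm) \<Rightarrow> bool" where
  "preserves M \<omega> g \<longleftrightarrow>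
     (\<forall>p\<in>frame_bundle (gs_order \<omega>) M. gs_map \<omega> (frame_map (gs_order \<omega>) M g p) = gs_map \<omega> p)"

definition action_preserves ::
  "('m, 'e::finite_dim_inner) mfd \<Rightarrow> ('g, 'x) monoid_scheme \<Rightarrow> ('g \<Rightarrow> 'm \<Rightarrow> 'm) \<Rightarrow>
   ('m, 'e, 'v, 'f) geom_structure \<Rightarrow> bool" where
  "action_preserves M \<Gamma> \<alpha> \<omega> \<longleftrightarrow> (\<forall>\<gamma>\<in>carrier \<Gamma>. preserves M \<omega> (\<alpha> \<gamma>))"

end

theory Submission
  imports Defs
begin

text \<open>
  Let \<open>f : N \<rightarrow> M\<close> be the orbit equivalence and pull \<open>\<omega>\<close> back to \<open>\<omega> \<circ> f\<^sup>k\<close>. For \<open>\<gamma>' \<in> \<Gamma>'\<close> the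
  diffeomorphism \<open>h = f \<circ> \<gamma>' \<circ> f\<^sup>-\<^sup>1\<close> of \<open>M\<close> maps every point into its \<open>\<Gamma>\<close>-orbit, so the countably
  many closed sets \<open>{x. h x = \<gamma> x}\<close> cover \<open>M\<close>. By Baire's theorem the union of their interiors is
  dense. Over it \<open>h\<close> coincides locally with an element of \<open>\<Gamma>\<close> and hence preserves \<open>\<omega>\<close>; by
  continuity of \<open>\<omega>\<close> and the Hausdorff property of its target, \<open>h\<close> preserves \<open>\<omega>\<close> everywhere.
\<close>

section \<open>Calculus of maps of class \<open>C\<^sup>k\<close>\<close>

text \<open>Agreement of two maps at a single point says nothing about their derivatives there. The
  interiors matter because on them the germs, hence the k-jets, coincide. The continuity argument
  then takes place in the frame bundle rather than in \<open>M\<close>: every frame has to be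
  approximated by frames over the dense set, and this is done by translating a representative in its
  parameter domain. Compactness enters through Baire, since a compact Hausdorff space is locally
  compact and regular. The pullback requires \<open>f\<close> to induce a well-defined continuous
  map of frames. Jets are stored as families of iterated derivatives, for which the chain rule of
  order k has no short closed form. Instead, induction on k shows that the jet of
  \<open>g \<circ> a\<close> depends continuously on the jet of \<open>a\<close>, for convergence
  along an arbitrary filter. Constant families then yield well-definedness, and a filter on
  representatives yields continuity. Equivariance survives because \<open>f\<close> composes with
  frames on the left and the jet group on the right.\<close>

lemma finite_orthonormal_basis:
  obtains B :: "'a::finite_dim_inner set"
  where "finite B" and "\<And>x. (\<Sum>b\<in>B. (x \<bullet> b) *\<^sub>R b) = x"
proof -
  obtain B0 :: "'a set" where B0: "finite B0" "\<forall>x. \<exists>c. x = (\<Sum>b\<in>B0. c b *\<^sub>R b)"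
    using finite_dim by blast
  obtain C where C: "finite C" "span C = span B0" "pairwise orthogonal C"
    using basis_orthogonal[OF B0(1)] by blast
  have span: "x \<in> span C" for x
  proof -
    obtain c where "x = (\<Sum>b\<in>B0. c b *\<^sub>R b)" using B0(2) by blast
    then show ?thesis by (simp add: C(2) span_sum span_scale span_base)
  qed
  \<comment> \<open>The orthogonal spanning set may contain 0, which has to go before the vectors
    are normalised; in the trivial space nothing remains and the empty sum is correct.\<close>
  define D where "D = C - {0}"
  have D: "finite D" "pairwise orthogonal D" "0 \<notin> D" "span D = span C"
    using C by (auto simp: D_def pairwise_def)
  define B where "B = (\<lambda>d. d /\<^sub>R norm d) ` D"
  have ortho: "d \<bullet> e = 0" if "d \<in> D" "e \<in> D" "d \<noteq> e" for d e
    using D(2) that by (auto simp: pairwise_def orthogonal_def)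
  have ne: "d \<noteq> 0" if "d \<in> D" for d using D(3) that by auto
  have inj: "inj_on (\<lambda>d. d /\<^sub>R norm d) D"
  proof (rule inj_onI, rule ccontr)
    fix d e assume "d \<in> D" "e \<in> D" "d /\<^sub>R norm d = e /\<^sub>R norm e" "d \<noteq> e"
    then have "(d /\<^sub>R norm d) \<bullet> (d /\<^sub>R norm d) = 0"
      by (metis inner_scaleR_left inner_scaleR_right mult_zero_right ortho)
    with ne[OF \<open>d \<in> D\<close>] show False by simp
  qed
  have eqn: "(\<Sum>b\<in>B. (x \<bullet> b) *\<^sub>R b) = (\<Sum>d\<in>D. ((x \<bullet> d) / (d \<bullet> d)) *\<^sub>R d)" for x
    unfolding B_def sum.reindex[OF inj] o_def
    by (intro sum.cong refl)
      (simp add: field_simps dot_square_norm power2_eq_square)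
  have main: "(\<Sum>d\<in>D. ((x \<bullet> d) / (d \<bullet> d)) *\<^sub>R d) = x" for x
  proof -
    have "x \<in> span D" using span D by simp
    then show ?thesis
    proof (induction rule: span_induct_alt)
      case base
      then show ?case by simp
    next
      case (step c y z)
      have "(\<Sum>d\<in>D. ((y \<bullet> d) / (d \<bullet> d)) *\<^sub>R d) = (\<Sum>d\<in>D. if d = y then y else 0)"
        using step(1) ortho ne by (intro sum.cong) auto
      also have "\<dots> = y" using step(1) D(1) by simp
      finally have y: "(\<Sum>d\<in>D. ((y \<bullet> d) / (d \<bullet> d)) *\<^sub>R d) = y" .
      have "(\<Sum>d\<in>D. (((c *\<^sub>R y + z) \<bullet> d) / (d \<bullet> d)) *\<^sub>R d)
          = c *\<^sub>R (\<Sum>d\<in>D. ((y \<bullet> d) / (d \<bullet> d)) *\<^sub>R d) + (\<Sum>d\<in>D. ((z \<bullet> d) / (d \<bullet> d)) *\<^sub>R d)"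
        by (simp add: scaleR_sum_right inner_add_left add_divide_distrib scaleR_add_left
            flip: sum.distrib)
      then show ?case using y step(2) by simp
    qed
  qed
  show ?thesis
  proof (rule that[of B])
    show "finite B" using D(1) by (simp add: B_def)
  qed (simp add: eqn main)
qed

lemma frechet_derivative_eqI: "(f has_derivative f') (at x) \<Longrightarrow> frechet_derivative f (at x) = f'"
  by (metis frechet_derivative_at)

text \<open>No differentiability is assumed: \<open>frechet_derivative\<close> is a choice among the
  derivatives at \<open>x\<close>, and the two functions have the same derivatives, possibly
  none.\<close>

lemma frechet_derivative_eq_on_open:
  assumes "open S" "x \<in> S" "\<And>y. y \<in> S \<Longrightarrow> f y = g y"
  shows "frechet_derivative f (at x) = frechet_derivative g (at x)"
proof -
  have "(f has_derivative D) (at x) \<longleftrightarrow> (g has_derivative D) (at x)" for D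
    using assms has_derivative_transform_within_open[of f D x UNIV S g]
      has_derivative_transform_within_open[of g D x UNIV S f] by auto
  then show ?thesis unfolding frechet_derivative_def by presburger
qed

lemma differentiable_eq_on_open:
  assumes "open S" "x \<in> S" "\<And>y. y \<in> S \<Longrightarrow> f y = g y"
  shows "f differentiable (at x) \<longleftrightarrow> g differentiable (at x)"
  unfolding differentiable_def
  using assms has_derivative_transform_within_open[of f _ x UNIV S g]
      has_derivative_transform_within_open[of g _ x UNIV S f] by metis

text \<open>\<open>Ck_on\<close> uses full derivatives at points of \<open>S\<close>, so agreement
  on \<open>S\<close> has to be agreement near each of its points; this is where openness
  enters.\<close>

lemma Ck_on_cong:
  assumes "open S" "\<And>x. x \<in> S \<Longrightarrow> f x = g x"
  shows "Ck_on k S f \<longleftrightarrow> Ck_on k S g"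
  using assms(2)
proof (induction k arbitrary: f g)
  case 0
  then show ?case by (simp cong: continuous_on_cong)
next
  case (Suc k)
  have "Ck_on k S (\<lambda>x. frechet_derivative f (at x) v)
      \<longleftrightarrow> Ck_on k S (\<lambda>x. frechet_derivative g (at x) v)" for v
    using frechet_derivative_eq_on_open[OF assms(1) _ Suc(2)] by (intro Suc.IH) auto
  then show ?case using differentiable_eq_on_open[OF assms(1) _ Suc(2)] by auto
qed

lemma Ck_on_subset: "Ck_on k S f \<Longrightarrow> T \<subseteq> S \<Longrightarrow> Ck_on k T f"
  by (induction k arbitrary: f) (auto intro: continuous_on_subset)

lemma Ck_on_local:
  assumes "\<And>x. x \<in> S \<Longrightarrow> \<exists>T. open T \<and> x \<in> T \<and> Ck_on k T f"
  shows "Ck_on k S f"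
  using assms
proof (induction k arbitrary: f)
  case 0
  show ?case
    unfolding Ck_on.simps continuous_on_eq_continuous_within
  proof
    fix x assume "x \<in> S"
    with 0 obtain T where "open T" "x \<in> T" "continuous_on T f" by auto
    then show "continuous (at x within S) f"
      using continuous_at_imp_continuous_within continuous_on_eq_continuous_at by blast
  qed
next
  case (Suc k)
  show ?case
    unfolding Ck_on.simps
  proof (intro conjI allI ballI)
    show "f differentiable at x" if "x \<in> S" for x
      using Suc.prems[OF that] by auto
    show "Ck_on k S (\<lambda>x. frechet_derivative f (at x) v)" for v
    proof (rule Suc.IH)
      fix x assume "x \<in> S"
      from Suc.prems[OF this] show "\<exists>T. open T \<and> x \<in> T \<and> Ck_on k T (\<lambda>x. frechet_derivative f (at x) v)"
        by auto
    qed
  qed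
qed

lemma Ck_on_imp_continuous_on: "Ck_on k S f \<Longrightarrow> continuous_on S f"
  by (cases k)
    (auto intro!: differentiable_imp_continuous_on
      simp: differentiable_on_def differentiable_at_withinI)

lemma Ck_on_Suc_imp: "Ck_on (Suc k) S f \<Longrightarrow> Ck_on k S f"
proof (induction k arbitrary: f)
  case 0
  then show ?case using Ck_on_imp_continuous_on by (metis Ck_on.simps(1))
next
  case (Suc k)
  then have "f differentiable at x" if "x \<in> S" for x
    using that by (metis Ck_on.simps(2))
  moreover have "Ck_on k S (\<lambda>x. frechet_derivative f (at x) v)" for v
    by (rule Suc.IH) (metis Ck_on.simps(2) Suc.prems)
  ultimately show ?case by simp
qed

lemma Ck_on_le: "Ck_on k S f \<Longrightarrow> j \<le> k \<Longrightarrow> Ck_on j S f"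
proof (induction k)
  case (Suc k)
  then show ?case using Ck_on_Suc_imp by (cases "j = Suc k") auto
qed simp

lemma Ck_on_const: "Ck_on k S (\<lambda>x. c)"
  by (induction k arbitrary: c) auto

lemma frechet_derivative_add:
  assumes "f differentiable at x" "g differentiable at x"
  shows "frechet_derivative (\<lambda>x. f x + g x) (at x) v
      = frechet_derivative f (at x) v + frechet_derivative g (at x) v"
proof -
  have "(f has_derivative frechet_derivative f (at x)) (at x)"
    and "(g has_derivative frechet_derivative g (at x)) (at x)"
    using assms by (simp_all flip: frechet_derivative_works)
  from frechet_derivative_eqI[OF has_derivative_add[OF this]] show ?thesis by simp
qed

lemma Ck_on_ident: "Ck_on k S (\<lambda>x. x)"
  by (cases k) (simp_all add: Ck_on_const)

lemma Ck_on_add: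
  assumes "open S"
  shows "Ck_on k S f \<Longrightarrow> Ck_on k S g \<Longrightarrow> Ck_on k S (\<lambda>x. f x + g x)"
proof (induction k arbitrary: f g)
  case 0
  then show ?case by (simp add: continuous_on_add)
next
  case (Suc k)
  have D: "frechet_derivative (\<lambda>x. f x + g x) (at x) v
      = frechet_derivative f (at x) v + frechet_derivative g (at x) v" if "x \<in> S" for x v
    using Suc.prems that by (intro frechet_derivative_add) auto
  then have "Ck_on k S (\<lambda>x. frechet_derivative (\<lambda>x. f x + g x) (at x) v)" for v
    using Suc by (subst Ck_on_cong[OF assms D]) auto
  then show ?case using Suc.prems by (auto intro: differentiable_add)
qed

lemma Ck_on_sum:
  assumes "open S" "\<And>i. i \<in> I \<Longrightarrow> Ck_on k S (f i)"
  shows "Ck_on k S (\<lambda>x. \<Sum>i\<in>I. f i x)"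
  using assms(2)
proof (induction I rule: infinite_finite_induct)
  case (insert i I)
  have "Ck_on k S (\<lambda>x. f i x + (\<Sum>i\<in>I. f i x))"
    by (rule Ck_on_add[OF assms(1) _ insert.IH]) (auto intro: insert.prems)
  with insert(1,2) show ?case by simp
qed (simp_all add: Ck_on_const)

lemma frechet_derivative_scaleR:
  assumes "f differentiable at x" "g differentiable at x"
  shows "frechet_derivative (\<lambda>x. f x *\<^sub>R g x) (at x) v
      = f x *\<^sub>R frechet_derivative g (at x) v + frechet_derivative f (at x) v *\<^sub>R g x"
proof -
  have "(f has_derivative frechet_derivative f (at x)) (at x)"
    and "(g has_derivative frechet_derivative g (at x)) (at x)"
    using assms by (simp_all flip: frechet_derivative_works)
  from frechet_derivative_eqI[OF has_derivative_scaleR[OF this]] show ?thesis by simp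
qed

lemma Ck_on_scaleR:
  assumes "open S"
  shows "Ck_on k S f \<Longrightarrow> Ck_on k S g \<Longrightarrow> Ck_on k S (\<lambda>x. f x *\<^sub>R g x)"
proof (induction k arbitrary: f g)
  case 0
  then show ?case by (simp add: continuous_on_scaleR)
next
  case (Suc k)
  have D: "frechet_derivative (\<lambda>x. f x *\<^sub>R g x) (at x) v
      = f x *\<^sub>R frechet_derivative g (at x) v + frechet_derivative f (at x) v *\<^sub>R g x" if "x \<in> S" for x v
    using Suc.prems that by (intro frechet_derivative_scaleR) auto
  \<comment> \<open>The Leibniz terms still contain \<open>f\<close> and \<open>g\<close>
    undifferentiated, so the induction hypothesis is applied to them at order k.\<close>
  have "Ck_on k S f" "Ck_on k S g"
    using Suc.prems Ck_on_Suc_imp by auto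
  then have "Ck_on k S (\<lambda>x. frechet_derivative (\<lambda>x. f x *\<^sub>R g x) (at x) v)" for v
    using Suc by (subst Ck_on_cong[OF assms D]) (auto intro!: Ck_on_add assms)
  then show ?case using Suc.prems by (auto intro: differentiable_scaleR)
qed

lemma frechet_derivative_bounded_linear:
  assumes "bounded_linear L" "f differentiable at x"
  shows "frechet_derivative (\<lambda>x. L (f x)) (at x) v = L (frechet_derivative f (at x) v)"
proof -
  have "(f has_derivative frechet_derivative f (at x)) (at x)"
    using assms by (simp flip: frechet_derivative_works)
  from frechet_derivative_eqI[OF bounded_linear.has_derivative[OF assms(1) this]]
  show ?thesis by simp
qed

lemma differentiable_bounded_linear:
  assumes "bounded_linear L" "f differentiable at x"
  shows "(\<lambda>x. L (f x)) differentiable at x"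
  using assms bounded_linear.has_derivative unfolding differentiable_def by blast

lemma Ck_on_bounded_linear:
  assumes "open S" "bounded_linear L"
  shows "Ck_on k S f \<Longrightarrow> Ck_on k S (\<lambda>x. L (f x))"
proof (induction k arbitrary: f)
  case 0
  then show ?case by (simp add: bounded_linear.continuous_on[OF assms(2)])
next
  case (Suc k)
  have "Ck_on k S (\<lambda>x. frechet_derivative (\<lambda>x. L (f x)) (at x) v)" for v
    using Suc
    by (subst Ck_on_cong[OF assms(1), of _ "\<lambda>x. L (frechet_derivative f (at x) v)"])
      (auto simp: frechet_derivative_bounded_linear[OF assms(2)])
  then show ?case using Suc.prems by (auto intro: differentiable_bounded_linear[OF assms(2)])
qed

text \<open>In the usual chain rule the derivative of \<open>g\<close> is taken in a direction that
  moves with \<open>x\<close>, whereas \<open>Ck_on\<close> and \<open>iter_deriv\<close> only speak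
  of fixed directions. Expanding the moving direction in a basis leaves a sum of products of scalar
  coordinates and derivatives of \<open>g\<close> in fixed directions, to which the rules for sums
  and products apply.\<close>

lemma frechet_derivative_compose_basis:
  assumes "\<And>y. (\<Sum>b\<in>B. (y \<bullet> b) *\<^sub>R b) = y"
    and "f differentiable at x" "g differentiable at (f x)"
  shows "frechet_derivative (g \<circ> f) (at x) v
    = (\<Sum>b\<in>B. (frechet_derivative f (at x) v \<bullet> b) *\<^sub>R frechet_derivative g (at (f x)) b)"
proof -
  interpret bounded_linear "frechet_derivative g (at (f x))"
    using assms(3) frechet_derivative_works has_derivative_bounded_linear by blast
  have "frechet_derivative (g \<circ> f) (at x) v
      = frechet_derivative g (at (f x)) (frechet_derivative f (at x) v)"
    using frechet_derivative_compose[OF assms(2,3)] by simp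
  also have "\<dots> = frechet_derivative g (at (f x)) (\<Sum>b\<in>B. (frechet_derivative f (at x) v \<bullet> b) *\<^sub>R b)"
    by (simp only: assms(1))
  also have "\<dots> = (\<Sum>b\<in>B. (frechet_derivative f (at x) v \<bullet> b) *\<^sub>R frechet_derivative g (at (f x)) b)"
    by (simp add: sum scaleR)
  finally show ?thesis .
qed

lemma Ck_on_compose:
  fixes f :: "'a::finite_dim_inner \<Rightarrow> 'b::finite_dim_inner"
    and g :: "'b \<Rightarrow> 'c::finite_dim_inner"
  assumes "open S"
  shows "Ck_on k S f \<Longrightarrow> Ck_on k T g \<Longrightarrow> f ` S \<subseteq> T \<Longrightarrow> Ck_on k S (g \<circ> f)"
proof (induction k arbitrary: g)
  case 0
  then show ?case by (metis Ck_on.simps(1) continuous_on_compose continuous_on_subset)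
next
  case (Suc k)
  obtain B :: "'b set" where B: "finite B" "\<And>y. (\<Sum>b\<in>B. (y \<bullet> b) *\<^sub>R b) = y"
    using finite_orthonormal_basis by blast
  have D: "frechet_derivative (g \<circ> f) (at x) v
    = (\<Sum>b\<in>B. (frechet_derivative f (at x) v \<bullet> b) *\<^sub>R ((\<lambda>y. frechet_derivative g (at y) b) \<circ> f) x)"
    if "x \<in> S" for x v
    using Suc.prems that by (simp add: frechet_derivative_compose_basis[OF B(2)] subset_iff)
  \<comment> \<open>The induction varies only the outer map: derivatives of \<open>g\<close> in a
    fixed direction are composed with the same \<open>f\<close>, now regarded as a map of order
    k.\<close>
  have f: "Ck_on k S f" using Suc.prems(1) by (rule Ck_on_Suc_imp)
  have "Ck_on k S (\<lambda>x. frechet_derivative (g \<circ> f) (at x) v)" for v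
  proof (rule iffD2[OF Ck_on_cong[OF assms D]], assumption, intro Ck_on_sum Ck_on_scaleR assms)
    fix b
    show "Ck_on k S (\<lambda>x. frechet_derivative f (at x) v \<bullet> b)"
      using Suc.prems(1) by (intro Ck_on_bounded_linear[OF assms bounded_linear_inner_left]) simp
    show "Ck_on k S ((\<lambda>y. frechet_derivative g (at y) b) \<circ> f)"
      using Suc.prems(2,3) f by (intro Suc.IH) auto
  qed
  moreover have "(g \<circ> f) differentiable at x" if "x \<in> S" for x
    using Suc.prems that by (auto intro!: differentiable_chain_at)
  ultimately show ?case by (simp del: o_apply)
qed

section \<open>Continuity of composition on jets\<close>

text \<open>Only the germ at 0 counts: the members of a family of maps may be regular on
  neighbourhoods of 0 of no common size.\<close>

definition Ck_near :: "nat \<Rightarrow> ('a::finite_dim_inner \<Rightarrow> 'b::finite_dim_inner) \<Rightarrow> bool" where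
  "Ck_near k f \<longleftrightarrow> (\<exists>S. open S \<and> 0 \<in> S \<and> Ck_on k S f)"

text \<open>The filter and its index type are arbitrary so that one notion serves constant
  sequences, translates indexed by the shift, and families of all representatives near a given
  frame.\<close>

definition jets_tendsto ::
  "nat \<Rightarrow> ('t \<Rightarrow> 'a::finite_dim_inner \<Rightarrow> 'b::finite_dim_inner) \<Rightarrow> ('a \<Rightarrow> 'b) \<Rightarrow> 't filter \<Rightarrow> bool" where
  "jets_tendsto k a b F \<longleftrightarrow>
     (\<forall>vs. length vs \<le> k \<longrightarrow> ((\<lambda>t. iter_deriv vs (a t) 0) \<longlongrightarrow> iter_deriv vs b 0) F)"

lemma Ck_near_Suc_imp: "Ck_near (Suc k) f \<Longrightarrow> Ck_near k f"
  unfolding Ck_near_def using Ck_on_Suc_imp by blast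

lemma Ck_near_SucD:
  assumes "Ck_near (Suc k) f"
  shows "\<forall>\<^sub>F x in nhds 0. f differentiable at x"
    and "Ck_near k (\<lambda>x. frechet_derivative f (at x) v)"
  using assms unfolding Ck_near_def eventually_nhds by auto

lemma Ck_near_binary:
  assumes "Ck_near k f" "Ck_near k g"
  obtains S where "open S" "0 \<in> S" "Ck_on k S f" "Ck_on k S g"
proof -
  obtain S T where "open S" "0 \<in> S" "Ck_on k S f" "open T" "0 \<in> T" "Ck_on k T g"
    using assms unfolding Ck_near_def by blast
  then show ?thesis
    by (intro that[of "S \<inter> T"]) (auto intro: Ck_on_subset)
qed

lemma Ck_near_add:
  assumes "Ck_near k f" "Ck_near k g"
  shows "Ck_near k (\<lambda>x. f x + g x)"
  by (rule Ck_near_binary[OF assms]) (auto simp: Ck_near_def intro: Ck_on_add)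

lemma Ck_near_scaleR:
  assumes "Ck_near k f" "Ck_near k g"
  shows "Ck_near k (\<lambda>x. f x *\<^sub>R g x)"
  by (rule Ck_near_binary[OF assms]) (auto simp: Ck_near_def intro: Ck_on_scaleR)

lemma Ck_near_const: "Ck_near k (\<lambda>x. c)"
  unfolding Ck_near_def using Ck_on_const open_UNIV by blast

lemma Ck_near_sum:
  assumes "\<And>i. i \<in> I \<Longrightarrow> Ck_near k (f i)"
  shows "Ck_near k (\<lambda>x. \<Sum>i\<in>I. f i x)"
  using assms
proof (induction I rule: infinite_finite_induct)
  case (insert i I)
  have "Ck_near k (\<lambda>x. f i x + (\<Sum>i\<in>I. f i x))"
    by (rule Ck_near_add[OF _ insert.IH]) (auto intro: insert.prems)
  with insert(1,2) show ?case by simp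
qed (simp_all add: Ck_near_const)

lemma Ck_near_bounded_linear:
  "bounded_linear L \<Longrightarrow> Ck_near k f \<Longrightarrow> Ck_near k (\<lambda>x. L (f x))"
  unfolding Ck_near_def using Ck_on_bounded_linear by blast

lemma Ck_near_imp_continuous: "Ck_near k f \<Longrightarrow> isCont f 0"
  unfolding Ck_near_def using Ck_on_imp_continuous_on continuous_on_eq_continuous_at by blast

lemma Ck_near_eventually:
  assumes "Ck_near k f" "open T" "f 0 \<in> T"
  shows "\<forall>\<^sub>F x in nhds 0. f x \<in> T"
  using Ck_near_imp_continuous[OF assms(1)] assms(2,3)
  by (auto simp: continuous_at_open eventually_nhds)

lemma Ck_near_compose:
  assumes "Ck_near k f" "Ck_on k T g" "open T" "f 0 \<in> T"
  shows "Ck_near k (g \<circ> f)"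
proof -
  obtain S where S: "open S" "0 \<in> S" "Ck_on k S f"
    using assms(1) unfolding Ck_near_def by blast
  obtain R where R: "open R" "0 \<in> R" "\<And>x. x \<in> R \<Longrightarrow> f x \<in> T"
    using Ck_near_eventually[OF assms(1,3,4)] unfolding eventually_nhds by blast
  have "Ck_on k (S \<inter> R) (g \<circ> f)"
    using S R assms(2) by (intro Ck_on_compose[where T = T]) (auto intro: Ck_on_subset)
  with S R show ?thesis unfolding Ck_near_def by (intro exI[of _ "S \<inter> R"]) auto
qed

text \<open>\<open>iter_deriv\<close> applies the head of the list last, so the final entry is the
  first derivative taken. Peeling from the end matches the recursion of \<open>Ck_on\<close>, which
  differentiates and then asks for regularity of the result.\<close>

lemma iter_deriv_snoc:
  "iter_deriv (vs @ [v]) f = iter_deriv vs (\<lambda>x. frechet_derivative f (at x) v)"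
  by (induction vs) auto

lemma iter_deriv_eventually_eq:
  "\<forall>\<^sub>F y in nhds x. f y = g y \<Longrightarrow> iter_deriv vs f x = iter_deriv vs g x"
proof -
  assume "\<forall>\<^sub>F y in nhds x. f y = g y"
  then obtain S where S: "open S" "x \<in> S" "\<And>y. y \<in> S \<Longrightarrow> f y = g y"
    unfolding eventually_nhds by blast
  have "iter_deriv vs f y = iter_deriv vs g y" if "y \<in> S" for y
    using that
  proof (induction vs arbitrary: y)
    case (Cons v vs)
    then show ?case using frechet_derivative_eq_on_open[OF S(1) Cons.prems Cons.IH] by simp
  qed (use S in simp)
  with S(2) show ?thesis by simp
qed

lemma jets_tendsto_0: "jets_tendsto 0 a b F \<longleftrightarrow> ((\<lambda>t. a t 0) \<longlongrightarrow> b 0) F"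
  by (simp add: jets_tendsto_def)

text \<open>Splitting off the first derivative taken gives a recursion parallel to that of
  \<open>Ck_on\<close>; the rules for convergence of jets can then be proved by the same inductions
  as the rules for C^k maps.\<close>

lemma jets_tendsto_Suc:
  "jets_tendsto (Suc k) a b F \<longleftrightarrow> ((\<lambda>t. a t 0) \<longlongrightarrow> b 0) F \<and>
     (\<forall>v. jets_tendsto k (\<lambda>t x. frechet_derivative (a t) (at x) v)
             (\<lambda>x. frechet_derivative b (at x) v) F)"
  (is "?L \<longleftrightarrow> ?R1 \<and> ?R2")
proof
  assume L: ?L
  from L[unfolded jets_tendsto_def, rule_format, of "[]"] have ?R1 by simp
  moreover from L[unfolded jets_tendsto_def, rule_format, of "vs @ [v]" for vs v] have ?R2
    by (simp add: jets_tendsto_def iter_deriv_snoc)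
  ultimately show "?R1 \<and> ?R2" ..
next
  assume R: "?R1 \<and> ?R2"
  show ?L
    unfolding jets_tendsto_def
  proof (intro allI impI)
    fix vs :: "'b list" assume le: "length vs \<le> Suc k"
    show "((\<lambda>t. iter_deriv vs (a t) 0) \<longlongrightarrow> iter_deriv vs b 0) F"
    proof (cases vs rule: rev_cases)
      case Nil
      then show ?thesis using R by simp
    next
      case (snoc ws w)
      with le R show ?thesis by (simp add: iter_deriv_snoc jets_tendsto_def)
    qed
  qed
qed

lemma jets_tendsto_value: "jets_tendsto k a b F \<Longrightarrow> ((\<lambda>t. a t 0) \<longlongrightarrow> b 0) F"
  unfolding jets_tendsto_def by (drule spec[of _ "[]"]) simp

lemma jets_tendsto_Suc_imp: "jets_tendsto (Suc k) a b F \<Longrightarrow> jets_tendsto k a b F"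
  unfolding jets_tendsto_def by simp

text \<open>The neighbourhood of 0 on which \<open>a t\<close> and \<open>a' t\<close> agree may
  depend on \<open>t\<close>, because only derivatives at 0 are compared.\<close>

lemma jets_tendsto_cong:
  assumes "\<forall>\<^sub>F t in F. \<forall>\<^sub>F x in nhds 0. a t x = a' t x" "\<forall>\<^sub>F x in nhds 0. b x = b' x"
    and "jets_tendsto k a' b' F"
  shows "jets_tendsto k a b F"
  unfolding jets_tendsto_def
proof (intro allI impI)
  fix vs :: "'b list" assume "length vs \<le> k"
  with assms(3) have "((\<lambda>t. iter_deriv vs (a' t) 0) \<longlongrightarrow> iter_deriv vs b' 0) F"
    by (simp add: jets_tendsto_def)
  moreover have "\<forall>\<^sub>F t in F. iter_deriv vs (a' t) 0 = iter_deriv vs (a t) 0"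
    using assms(1) by eventually_elim (simp add: iter_deriv_eventually_eq)
  moreover have "iter_deriv vs b' 0 = iter_deriv vs b 0"
    using assms(2) by (simp add: iter_deriv_eventually_eq)
  ultimately show "((\<lambda>t. iter_deriv vs (a t) 0) \<longlongrightarrow> iter_deriv vs b 0) F"
    by (metis Lim_transform_eventually)
qed

lemma jets_tendsto_const: "jets_tendsto k (\<lambda>t. c) c F"
  by (simp add: jets_tendsto_def)

text \<open>Regularity near 0 and not just at 0 is assumed because the sum rule is differentiated
  further, so it has to hold as an identity of germs. The same applies to products, linear maps and
  compositions below.\<close>

lemma jets_tendsto_add:
  "jets_tendsto k a b F \<Longrightarrow> jets_tendsto k c d F \<Longrightarrow>
   \<forall>\<^sub>F t in F. Ck_near k (a t) \<Longrightarrow> Ck_near k b \<Longrightarrow>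
   \<forall>\<^sub>F t in F. Ck_near k (c t) \<Longrightarrow> Ck_near k d \<Longrightarrow>
   jets_tendsto k (\<lambda>t x. a t x + c t x) (\<lambda>x. b x + d x) F"
proof (induction k arbitrary: a b c d)
  case 0
  then show ?case by (simp add: jets_tendsto_0 tendsto_add)
next
  case (Suc k)
  show ?case
    unfolding jets_tendsto_Suc
  proof (intro conjI allI)
    show "((\<lambda>t. a t 0 + c t 0) \<longlongrightarrow> b 0 + d 0) F"
      using Suc.prems by (auto intro: tendsto_add jets_tendsto_value)
    fix v
    have main: "jets_tendsto k
        (\<lambda>t x. frechet_derivative (a t) (at x) v + frechet_derivative (c t) (at x) v)
        (\<lambda>x. frechet_derivative b (at x) v + frechet_derivative d (at x) v) F"
      using Suc.prems
      by (intro Suc.IH) (auto simp: jets_tendsto_Suc intro: Ck_near_SucD(2) elim: eventually_mono)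
    have eq: "\<forall>\<^sub>F x in nhds 0. frechet_derivative (\<lambda>x. f x + g x) (at x) v
        = frechet_derivative f (at x) v + frechet_derivative g (at x) v"
      if "Ck_near (Suc k) f" "Ck_near (Suc k) g" for f g :: "'b \<Rightarrow> 'c"
      using Ck_near_SucD(1)[OF that(1)] Ck_near_SucD(1)[OF that(2)]
      by eventually_elim (rule frechet_derivative_add)
    show "jets_tendsto k (\<lambda>t x. frechet_derivative (\<lambda>x. a t x + c t x) (at x) v)
        (\<lambda>x. frechet_derivative (\<lambda>x. b x + d x) (at x) v) F"
    proof (rule jets_tendsto_cong[OF _ _ main])
      show "\<forall>\<^sub>F t in F. \<forall>\<^sub>F x in nhds 0. frechet_derivative (\<lambda>x. a t x + c t x) (at x) v
          = frechet_derivative (a t) (at x) v + frechet_derivative (c t) (at x) v"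
        using Suc.prems(3,5) by eventually_elim (rule eq)
    qed (rule eq[OF Suc.prems(4,6)])
  qed
qed

lemma jets_tendsto_sum:
  assumes "\<And>i. i \<in> I \<Longrightarrow> jets_tendsto k (a i) (b i) F"
    and "\<And>i. i \<in> I \<Longrightarrow> \<forall>\<^sub>F t in F. Ck_near k (a i t)"
    and "\<And>i. i \<in> I \<Longrightarrow> Ck_near k (b i)"
  shows "jets_tendsto k (\<lambda>t x. \<Sum>i\<in>I. a i t x) (\<lambda>x. \<Sum>i\<in>I. b i x) F"
  using assms
proof (induction I rule: infinite_finite_induct)
  case (insert i I)
  have "\<forall>\<^sub>F t in F. \<forall>j\<in>I. Ck_near k (a j t)"
    using insert by (intro eventually_ball_finite) auto
  then have "\<forall>\<^sub>F t in F. Ck_near k (\<lambda>x. \<Sum>j\<in>I. a j t x)"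
    by eventually_elim (auto intro: Ck_near_sum)
  then have "jets_tendsto k (\<lambda>t x. a i t x + (\<Sum>j\<in>I. a j t x)) (\<lambda>x. b i x + (\<Sum>j\<in>I. b j x)) F"
    using insert by (intro jets_tendsto_add Ck_near_sum) auto
  with insert(1,2) show ?case by simp
qed (simp_all add: jets_tendsto_const)

lemma jets_tendsto_scaleR:
  "jets_tendsto k a b F \<Longrightarrow> jets_tendsto k c d F \<Longrightarrow>
   \<forall>\<^sub>F t in F. Ck_near k (a t) \<Longrightarrow> Ck_near k b \<Longrightarrow>
   \<forall>\<^sub>F t in F. Ck_near k (c t) \<Longrightarrow> Ck_near k d \<Longrightarrow>
   jets_tendsto k (\<lambda>t x. a t x *\<^sub>R c t x) (\<lambda>x. b x *\<^sub>R d x) F"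
proof (induction k arbitrary: a b c d)
  case 0
  then show ?case by (simp add: jets_tendsto_0 tendsto_scaleR)
next
  case (Suc k)
  show ?case
    unfolding jets_tendsto_Suc
  proof (intro conjI allI)
    show "((\<lambda>t. a t 0 *\<^sub>R c t 0) \<longlongrightarrow> b 0 *\<^sub>R d 0) F"
      using Suc.prems by (auto intro: tendsto_scaleR jets_tendsto_value)
    fix v
    have near: "\<forall>\<^sub>F t in F. Ck_near k (a t)" "\<forall>\<^sub>F t in F. Ck_near k (c t)"
      "\<forall>\<^sub>F t in F. Ck_near k (\<lambda>x. frechet_derivative (a t) (at x) v)"
      "\<forall>\<^sub>F t in F. Ck_near k (\<lambda>x. frechet_derivative (c t) (at x) v)"
      "Ck_near k b" "Ck_near k d"
      "Ck_near k (\<lambda>x. frechet_derivative b (at x) v)" "Ck_near k (\<lambda>x. frechet_derivative d (at x) v)"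
      using Suc.prems(3-6) by (auto intro: Ck_near_Suc_imp Ck_near_SucD(2) elim: eventually_mono)
    have conv: "jets_tendsto k a b F" "jets_tendsto k c d F"
      "jets_tendsto k (\<lambda>t x. frechet_derivative (a t) (at x) v)
             (\<lambda>x. frechet_derivative b (at x) v) F"
      "jets_tendsto k (\<lambda>t x. frechet_derivative (c t) (at x) v)
             (\<lambda>x. frechet_derivative d (at x) v) F"
      using Suc.prems(1,2) by (auto intro: jets_tendsto_Suc_imp simp: jets_tendsto_Suc)
    have main: "jets_tendsto k
        (\<lambda>t x. a t x *\<^sub>R frechet_derivative (c t) (at x) v + frechet_derivative (a t) (at x) v *\<^sub>R c t x)
        (\<lambda>x. b x *\<^sub>R frechet_derivative d (at x) v + frechet_derivative b (at x) v *\<^sub>R d x) F"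
    proof (rule jets_tendsto_add)
      show "jets_tendsto k (\<lambda>t x. a t x *\<^sub>R frechet_derivative (c t) (at x) v)
          (\<lambda>x. b x *\<^sub>R frechet_derivative d (at x) v) F"
        using near conv by (intro Suc.IH)
      show "jets_tendsto k (\<lambda>t x. frechet_derivative (a t) (at x) v *\<^sub>R c t x)
          (\<lambda>x. frechet_derivative b (at x) v *\<^sub>R d x) F"
        using near conv by (intro Suc.IH)
      show "\<forall>\<^sub>F t in F. Ck_near k (\<lambda>x. a t x *\<^sub>R frechet_derivative (c t) (at x) v)"
        using near(1,4) by eventually_elim (rule Ck_near_scaleR)
      show "\<forall>\<^sub>F t in F. Ck_near k (\<lambda>x. frechet_derivative (a t) (at x) v *\<^sub>R c t x)"
        using near(2,3) by eventually_elim (rule Ck_near_scaleR)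
    qed (intro Ck_near_scaleR near)+
    have eq: "\<forall>\<^sub>F x in nhds 0. frechet_derivative (\<lambda>x. f x *\<^sub>R g x) (at x) v
        = f x *\<^sub>R frechet_derivative g (at x) v + frechet_derivative f (at x) v *\<^sub>R g x"
      if "Ck_near (Suc k) f" "Ck_near (Suc k) g" for f :: "'b \<Rightarrow> real" and g :: "'b \<Rightarrow> 'c"
      using Ck_near_SucD(1)[OF that(1)] Ck_near_SucD(1)[OF that(2)]
      by eventually_elim (rule frechet_derivative_scaleR)
    show "jets_tendsto k (\<lambda>t x. frechet_derivative (\<lambda>x. a t x *\<^sub>R c t x) (at x) v)
        (\<lambda>x. frechet_derivative (\<lambda>x. b x *\<^sub>R d x) (at x) v) F"
    proof (rule jets_tendsto_cong[OF _ _ main])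
      show "\<forall>\<^sub>F t in F. \<forall>\<^sub>F x in nhds 0. frechet_derivative (\<lambda>x. a t x *\<^sub>R c t x) (at x) v
          = a t x *\<^sub>R frechet_derivative (c t) (at x) v + frechet_derivative (a t) (at x) v *\<^sub>R c t x"
        using Suc.prems(3,5) by eventually_elim (rule eq)
    qed (rule eq[OF Suc.prems(4,6)])
  qed
qed

lemma jets_tendsto_bounded_linear:
  fixes a :: "'t \<Rightarrow> 'a::finite_dim_inner \<Rightarrow> 'b::finite_dim_inner"
    and L :: "'b \<Rightarrow> 'c::finite_dim_inner"
  assumes "bounded_linear L"
  shows "jets_tendsto k a b F \<Longrightarrow> \<forall>\<^sub>F t in F. Ck_near k (a t) \<Longrightarrow> Ck_near k b \<Longrightarrow>
   jets_tendsto k (\<lambda>t x. L (a t x)) (\<lambda>x. L (b x)) F"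
proof (induction k arbitrary: a b)
  case 0
  then show ?case by (simp add: jets_tendsto_0 bounded_linear.tendsto[OF assms])
next
  case (Suc k)
  show ?case
    unfolding jets_tendsto_Suc
  proof (intro conjI allI)
    show "((\<lambda>t. L (a t 0)) \<longlongrightarrow> L (b 0)) F"
      using Suc.prems by (auto intro: bounded_linear.tendsto[OF assms] jets_tendsto_value)
    fix v
    have main: "jets_tendsto k (\<lambda>t x. L (frechet_derivative (a t) (at x) v))
        (\<lambda>x. L (frechet_derivative b (at x) v)) F"
      using Suc.prems
      by (intro Suc.IH) (auto simp: jets_tendsto_Suc intro: Ck_near_SucD(2) elim: eventually_mono)
    have eq: "\<forall>\<^sub>F x in nhds 0. frechet_derivative (\<lambda>x. L (f x)) (at x) v
        = L (frechet_derivative f (at x) v)" if "Ck_near (Suc k) f" for f :: "'a \<Rightarrow> 'b"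
      using Ck_near_SucD(1)[OF that]
      by eventually_elim (rule frechet_derivative_bounded_linear[OF assms])
    show "jets_tendsto k (\<lambda>t x. frechet_derivative (\<lambda>x. L (a t x)) (at x) v)
        (\<lambda>x. frechet_derivative (\<lambda>x. L (b x)) (at x) v) F"
    proof (rule jets_tendsto_cong[OF _ _ main])
      show "\<forall>\<^sub>F t in F. \<forall>\<^sub>F x in nhds 0. frechet_derivative (\<lambda>x. L (a t x)) (at x) v
          = L (frechet_derivative (a t) (at x) v)"
        using Suc.prems(2) by eventually_elim (rule eq)
    qed (rule eq[OF Suc.prems(3)])
  qed
qed

text \<open>A limiting form of the chain rule of order k. By the basis expansion the derivative of
  \<open>g \<circ> a t\<close> is a sum of products of coordinates of the derivative of
  \<open>a t\<close> with fixed-direction derivatives of \<open>g\<close> along \<open>a t\<close>.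
  The former converge by hypothesis, the latter by induction, since one order is lost. Openness of
  \<open>T\<close> around \<open>b 0\<close> keeps the values \<open>a t 0\<close> eventually where
  \<open>g\<close> is regular.\<close>

lemma jets_tendsto_compose:
  fixes a :: "'t \<Rightarrow> 'a::finite_dim_inner \<Rightarrow> 'b::finite_dim_inner"
    and g :: "'b \<Rightarrow> 'c::finite_dim_inner"
  assumes "open T"
  shows "jets_tendsto k a b F \<Longrightarrow> \<forall>\<^sub>F t in F. Ck_near k (a t) \<Longrightarrow> Ck_near k b \<Longrightarrow>
   Ck_on k T g \<Longrightarrow> b 0 \<in> T \<Longrightarrow> jets_tendsto k (\<lambda>t. g \<circ> a t) (g \<circ> b) F"
proof (induction k arbitrary: g)
  case 0
  then have "isCont g (b 0)"
    using assms continuous_on_eq_continuous_at by auto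
  then show ?case
    using isCont_tendsto_compose[OF _ 0(1)[unfolded jets_tendsto_0]] by (simp add: jets_tendsto_0)
next
  case (Suc k)
  obtain B :: "'b set" where B: "finite B" "\<And>y. (\<Sum>b\<in>B. (y \<bullet> b) *\<^sub>R b) = y"
    using finite_orthonormal_basis by blast
  have val: "((\<lambda>t. a t 0) \<longlongrightarrow> b 0) F"
    using Suc.prems(1) by (rule jets_tendsto_value)
  have in_T: "\<forall>\<^sub>F t in F. a t 0 \<in> T"
    using val assms Suc.prems(5) by (rule topological_tendstoD)
  have gD: "Ck_on k T (\<lambda>y. frechet_derivative g (at y) e)" for e
    using Suc.prems(4) by simp
  show ?case
    unfolding jets_tendsto_Suc
  proof (intro conjI allI)
    have "isCont g (b 0)"
      using Ck_on_imp_continuous_on[OF Suc.prems(4)] assms Suc.prems(5)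
        continuous_on_eq_continuous_at by blast
    from isCont_tendsto_compose[OF this val]
    show "((\<lambda>t. (g \<circ> a t) 0) \<longlongrightarrow> (g \<circ> b) 0) F" by simp
    fix v
    have near: "\<forall>\<^sub>F t in F. Ck_near k (a t)" "Ck_near k b"
      "\<forall>\<^sub>F t in F. Ck_near k (\<lambda>x. frechet_derivative (a t) (at x) v \<bullet> e)"
      "Ck_near k (\<lambda>x. frechet_derivative b (at x) v \<bullet> e)"
      "\<forall>\<^sub>F t in F. Ck_near k ((\<lambda>y. frechet_derivative g (at y) e) \<circ> a t)"
      "Ck_near k ((\<lambda>y. frechet_derivative g (at y) e) \<circ> b)" for e
    proof -
      show a: "\<forall>\<^sub>F t in F. Ck_near k (a t)"
        using Suc.prems(2) by eventually_elim (rule Ck_near_Suc_imp)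
      show b: "Ck_near k b"
        using Suc.prems(3) by (rule Ck_near_Suc_imp)
      show "\<forall>\<^sub>F t in F. Ck_near k (\<lambda>x. frechet_derivative (a t) (at x) v \<bullet> e)"
        using Suc.prems(2)
        by eventually_elim (rule Ck_near_bounded_linear[OF bounded_linear_inner_left Ck_near_SucD(2)])
      show "Ck_near k (\<lambda>x. frechet_derivative b (at x) v \<bullet> e)"
        using Suc.prems(3)
        by (rule Ck_near_bounded_linear[OF bounded_linear_inner_left Ck_near_SucD(2)])
      show "\<forall>\<^sub>F t in F. Ck_near k ((\<lambda>y. frechet_derivative g (at y) e) \<circ> a t)"
        using a in_T by eventually_elim (intro Ck_near_compose[OF _ gD assms])
      show "Ck_near k ((\<lambda>y. frechet_derivative g (at y) e) \<circ> b)"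
        using b Suc.prems(5) by (intro Ck_near_compose[OF _ gD assms])
    qed
    have main: "jets_tendsto k
        (\<lambda>t x. \<Sum>e\<in>B. (frechet_derivative (a t) (at x) v \<bullet> e) *\<^sub>R
            ((\<lambda>y. frechet_derivative g (at y) e) \<circ> a t) x)
        (\<lambda>x. \<Sum>e\<in>B. (frechet_derivative b (at x) v \<bullet> e) *\<^sub>R
            ((\<lambda>y. frechet_derivative g (at y) e) \<circ> b) x) F"
    proof (intro jets_tendsto_sum jets_tendsto_scaleR near)
      fix e
      show "jets_tendsto k (\<lambda>t x. frechet_derivative (a t) (at x) v \<bullet> e)
          (\<lambda>x. frechet_derivative b (at x) v \<bullet> e) F"
        using Suc.prems(1-3)
        by (intro jets_tendsto_bounded_linear[OF bounded_linear_inner_left])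
          (auto simp: jets_tendsto_Suc intro: Ck_near_SucD(2) elim: eventually_mono)
      show "jets_tendsto k (\<lambda>t. (\<lambda>y. frechet_derivative g (at y) e) \<circ> a t)
          ((\<lambda>y. frechet_derivative g (at y) e) \<circ> b) F"
        using near(1,2) gD Suc.prems(5) jets_tendsto_Suc_imp[OF Suc.prems(1)]
        by (intro Suc.IH)
      show "\<forall>\<^sub>F t in F. Ck_near k (\<lambda>x. (frechet_derivative (a t) (at x) v \<bullet> e) *\<^sub>R
            ((\<lambda>y. frechet_derivative g (at y) e) \<circ> a t) x)"
        using near(3,5)[of e] by eventually_elim (rule Ck_near_scaleR)
      show "Ck_near k (\<lambda>x. (frechet_derivative b (at x) v \<bullet> e) *\<^sub>R
            ((\<lambda>y. frechet_derivative g (at y) e) \<circ> b) x)"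
        using near(4,6)[of e] by (rule Ck_near_scaleR)
    qed
    have eq: "\<forall>\<^sub>F x in nhds 0. frechet_derivative (g \<circ> f) (at x) v
        = (\<Sum>e\<in>B. (frechet_derivative f (at x) v \<bullet> e) *\<^sub>R
            ((\<lambda>y. frechet_derivative g (at y) e) \<circ> f) x)"
      if "Ck_near (Suc k) f" "f 0 \<in> T" for f :: "'a \<Rightarrow> 'b"
      using Ck_near_SucD(1)[OF that(1)] Ck_near_eventually[OF that(1) assms that(2)]
    proof eventually_elim
      case (elim x)
      then have "g differentiable at (f x)" using Suc.prems(4) by simp
      with elim(1) show ?case by (simp add: frechet_derivative_compose_basis[OF B(2)])
    qed
    show "jets_tendsto k (\<lambda>t x. frechet_derivative (g \<circ> a t) (at x) v)
        (\<lambda>x. frechet_derivative (g \<circ> b) (at x) v) F"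
    proof (rule jets_tendsto_cong[OF _ _ main])
      show "\<forall>\<^sub>F t in F. \<forall>\<^sub>F x in nhds 0. frechet_derivative (g \<circ> a t) (at x) v
          = (\<Sum>e\<in>B. (frechet_derivative (a t) (at x) v \<bullet> e) *\<^sub>R
              ((\<lambda>y. frechet_derivative g (at y) e) \<circ> a t) x)"
        using Suc.prems(2) in_T by eventually_elim (rule eq)
    qed (rule eq[OF Suc.prems(3,5)])
  qed
qed

section \<open>Equality of jets, translates, and the topology on jets\<close>

lemma jet0_eq_iff:
  "jet0 k f = jet0 k g \<longleftrightarrow> (\<forall>vs. length vs \<le> k \<longrightarrow> iter_deriv vs f 0 = iter_deriv vs g 0)"
  unfolding jet0_def fun_eq_iff by auto

lemma jet0_eventually_eq: "\<forall>\<^sub>F x in nhds 0. f x = g x \<Longrightarrow> jet0 k f = jet0 k g"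
  unfolding jet0_eq_iff using iter_deriv_eventually_eq by blast

text \<open>Convergence of a constant family encodes equality of jets, so that the continuity of composition
  on jets also shows that it is well defined on jets.\<close>

lemma jets_tendsto_const_iff:
  "jets_tendsto k (\<lambda>_::nat. a) b sequentially \<longleftrightarrow> jet0 k a = jet0 k b"
  by (simp add: jets_tendsto_def jet0_eq_iff LIMSEQ_const_iff)

text \<open>Translating by \<open>s\<close> and back by \<open>- s\<close> matches the derivatives
  of the two maps in both directions, so the identity holds without differentiability and can be
  iterated freely.\<close>

lemma frechet_derivative_shift:
  "frechet_derivative (\<lambda>x. f (x + s)) (at x) = frechet_derivative f (at (x + s))"
proof -
  have *: "((\<lambda>x. h (x + r)) has_derivative D) (at y)" if "(h has_derivative D) (at (y + r))"
    for h :: "'a \<Rightarrow> 'b" and r y D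
  proof -
    have "((\<lambda>x. x + r) has_derivative (\<lambda>x. x)) (at y)" by (auto intro!: derivative_eq_intros)
    from diff_chain_at[OF this that] show ?thesis by (simp add: o_def)
  qed
  have "((\<lambda>x. f (x + s)) has_derivative D) (at x) \<longleftrightarrow> (f has_derivative D) (at (x + s))" for D
    using *[of f D x s] *[of "\<lambda>x. f (x + s)" D "x + s" "- s"] by auto
  then show ?thesis unfolding frechet_derivative_def by simp
qed

lemma iter_deriv_shift: "iter_deriv vs (\<lambda>x. f (x + s)) = (\<lambda>x. iter_deriv vs f (x + s))"
proof (induction vs)
  case (Cons v vs)
  then show ?case by (simp add: frechet_derivative_shift)
qed simp

lemma Ck_on_iter_deriv:
  "Ck_on (length vs + j) S f \<Longrightarrow> Ck_on j S (iter_deriv vs f)"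
proof (induction vs arbitrary: f rule: rev_induct)
  case (snoc v vs)
  then have "Ck_on (length vs + j) S (\<lambda>x. frechet_derivative f (at x) v)" by simp
  from snoc.IH[OF this] show ?case by (simp only: iter_deriv_snoc)
qed simp

text \<open>After \<open>iter_deriv_shift\<close> the claim is the continuity at 0 of each
  derivative of order at most k.\<close>

lemma jets_tendsto_shift:
  assumes "Ck_near k f"
  shows "jets_tendsto k (\<lambda>s x. f (x + s)) f (nhds 0)"
  unfolding jets_tendsto_def
proof (intro allI impI)
  fix vs :: "'a list" assume "length vs \<le> k"
  obtain S where S: "open S" "0 \<in> S" "Ck_on k S f"
    using assms unfolding Ck_near_def by blast
  have "Ck_on 0 S (iter_deriv vs f)"
    using Ck_on_le[OF S(3) \<open>length vs \<le> k\<close>] by (intro Ck_on_iter_deriv) simp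
  then have "isCont (iter_deriv vs f) 0"
    using S continuous_on_eq_continuous_at by auto
  then show "((\<lambda>s. iter_deriv vs (\<lambda>x. f (x + s)) 0) \<longlongrightarrow> iter_deriv vs f 0) (nhds 0)"
    by (simp add: iter_deriv_shift continuous_at_imp_continuous_at_within tendsto_at_iff_tendsto_nhds isCont_def)
qed

text \<open>Open sets of functions are those of the product topology, so convergence is tested on
  one list of directions at a time; on lists longer than k every jet is 0.\<close>

lemma jets_tendsto_imp_tendsto_jet0:
  assumes "jets_tendsto k a b F" "open Q" "jet0 k b \<in> Q"
  shows "\<forall>\<^sub>F t in F. jet0 k (a t) \<in> Q"
proof -
  have "limitin (product_topology (\<lambda>_. euclidean) UNIV) (\<lambda>t. jet0 k (a t)) (jet0 k b) F"
    using assms(1) unfolding limitin_componentwise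
    by (auto simp: jets_tendsto_def jet0_def)
  then show ?thesis
    using assms(2,3) unfolding euclidean_product_topology limitin_canonical_iff
    by (rule topological_tendstoD)
qed

lemma tendsto_jet0_imp_jets_tendsto:
  assumes "((\<lambda>t. jet0 k (a t)) \<longlongrightarrow> jet0 k b) F"
  shows "jets_tendsto k a b F"
  unfolding jets_tendsto_def
proof (intro allI impI)
  fix vs :: "'b list" assume le: "length vs \<le> k"
  have "limitin (product_topology (\<lambda>_. euclidean) UNIV) (\<lambda>t. jet0 k (a t)) (jet0 k b) F"
    using assms unfolding euclidean_product_topology limitin_canonical_iff .
  then have "((\<lambda>t. jet0 k (a t) vs) \<longlongrightarrow> jet0 k b vs) F"
    unfolding limitin_componentwise by auto
  with le show "((\<lambda>t. iter_deriv vs (a t) 0) \<longlongrightarrow> iter_deriv vs b 0) F"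
    by (simp add: jet0_def)
qed

section \<open>Maps of class \<open>C\<^sup>k\<close> between manifolds\<close>

text \<open>The part of \<open>smooth_manifold\<close> on which composing and restricting C^k maps
  rests. It passes directly to open subsets of the model space and to \<open>open_submfd\<close>,
  where frames are parametrised.\<close>

definition charted :: "('m, 'e::finite_dim_inner) mfd \<Rightarrow> bool" where
  "charted M \<longleftrightarrow> (\<forall>(U, \<phi>)\<in>atlas M. chart_on (mtop M) U \<phi>) \<and>
     (\<Union>(U, \<phi>)\<in>atlas M. U) = topspace (mtop M)"

lemma smooth_manifold_charted: "smooth_manifold M \<Longrightarrow> charted M"
  by (simp add: smooth_manifold_def charted_def)

lemma charted_chart: "charted M \<Longrightarrow> (U, \<phi>) \<in> atlas M \<Longrightarrow> chart_on (mtop M) U \<phi>"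
  by (auto simp: charted_def)

lemma charted_openin: "charted B \<Longrightarrow> (W, \<psi>) \<in> atlas B \<Longrightarrow> openin (mtop B) W"
  by (auto simp: chart_on_def dest: charted_chart)

lemma charted_obtain:
  assumes "charted M" "x \<in> topspace (mtop M)"
  obtains U \<phi> where "(U, \<phi>) \<in> atlas M" "x \<in> U"
proof -
  have "x \<in> (\<Union>(U, \<phi>)\<in>atlas M. U)" using assms by (simp add: charted_def)
  then show ?thesis using that by auto
qed

lemma chart_subset: "chart_on X U \<phi> \<Longrightarrow> U \<subseteq> topspace X"
  by (simp add: chart_on_def openin_subset)

lemma chart_inj: "chart_on X U \<phi> \<Longrightarrow> inj_on \<phi> U"
  using homeomorphic_imp_injective_map[of "subtopology X U" _ \<phi>] chart_subset[of X U \<phi>]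
  by (auto simp: chart_on_def Int_absorb1)

lemma chart_inv: "chart_on X U \<phi> \<Longrightarrow> x \<in> U \<Longrightarrow> inv_into U \<phi> (\<phi> x) = x"
  by (rule inv_into_f_f[OF chart_inj])

lemma chart_open_image:
  assumes "chart_on X U \<phi>" "openin X T" "T \<subseteq> U"
  shows "open (\<phi> ` T)"
proof -
  have "open_map (subtopology X U) (top_of_set (\<phi> ` U)) \<phi>"
    using assms(1) by (simp add: chart_on_def homeomorphic_imp_open_map)
  moreover have "openin (subtopology X U) T"
    using assms by (simp add: openin_subset_topspace_eq openin_subtopology) blast
  ultimately have "openin (top_of_set (\<phi> ` U)) (\<phi> ` T)"
    by (simp add: open_map_def)
  moreover have "open (\<phi> ` U)" using assms(1) by (simp add: chart_on_def)
  ultimately show ?thesis using openin_open_trans by blast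
qed

text \<open>The coordinate domain of a map read in two charts is open, which is what makes the
  congruence and composition rules for \<open>Ck_on\<close> applicable on it.\<close>

lemma Ck_map_open_preimage:
  assumes "charted A" "charted B" "Ck_map k A B f" "(U, \<phi>) \<in> atlas A" "openin (mtop B) W"
  shows "openin (mtop A) (U \<inter> f -` W)" and "open (\<phi> ` (U \<inter> f -` W))"
proof -
  have U: "chart_on (mtop A) U \<phi>" using assms(1,4) by (rule charted_chart)
  have "openin (mtop A) {x \<in> topspace (mtop A). f x \<in> W}"
    using assms(3,5) by (auto simp: Ck_map_def intro: openin_continuous_map_preimage)
  then have "openin (mtop A) (U \<inter> {x \<in> topspace (mtop A). f x \<in> W})"
    using U by (simp add: chart_on_def openin_Int)
  moreover have "U \<inter> {x \<in> topspace (mtop A). f x \<in> W} = U \<inter> f -` W"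
    using chart_subset[OF U] by auto
  ultimately show "openin (mtop A) (U \<inter> f -` W)" by simp
  then show "open (\<phi> ` (U \<inter> f -` W))" by (rule chart_open_image[OF U]) auto
qed

lemma Ck_mapI:
  assumes "continuous_map (mtop A) (mtop B) f"
    and "\<And>U \<phi> V \<psi>. (U, \<phi>) \<in> atlas A \<Longrightarrow> (V, \<psi>) \<in> atlas B \<Longrightarrow>
      Ck_on k (\<phi> ` (U \<inter> f -` V)) (\<psi> \<circ> f \<circ> inv_into U \<phi>)"
  shows "Ck_map k A B f"
  using assms unfolding Ck_map_def by blast

lemma Ck_map_cong:
  assumes A: "charted A" and B: "charted B" and f: "Ck_map k A B f"
    and eq: "\<And>x. x \<in> topspace (mtop A) \<Longrightarrow> f x = g x"
  shows "Ck_map k A B g"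
proof (rule Ck_mapI)
  show "continuous_map (mtop A) (mtop B) g"
    using f eq by (auto simp: Ck_map_def intro: continuous_map_eq)
  fix U \<phi> V \<psi> assume U: "(U, \<phi>) \<in> atlas A" and V: "(V, \<psi>) \<in> atlas B"
  have UA: "U \<subseteq> topspace (mtop A)" using charted_chart[OF A U] by (rule chart_subset)
  then have "U \<inter> f -` V = U \<inter> g -` V" using eq by auto
  moreover have "Ck_on k (\<phi> ` (U \<inter> f -` V)) (\<psi> \<circ> f \<circ> inv_into U \<phi>)"
    using f U V by (auto simp: Ck_map_def)
  moreover have "Ck_on k (\<phi> ` (U \<inter> f -` V)) (\<psi> \<circ> f \<circ> inv_into U \<phi>)
      \<longleftrightarrow> Ck_on k (\<phi> ` (U \<inter> f -` V)) (\<psi> \<circ> g \<circ> inv_into U \<phi>)"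
  proof (rule Ck_on_cong)
    show "open (\<phi> ` (U \<inter> f -` V))"
      using Ck_map_open_preimage(2)[OF A B f U charted_openin[OF B V]] .
    show "(\<psi> \<circ> f \<circ> inv_into U \<phi>) y = (\<psi> \<circ> g \<circ> inv_into U \<phi>) y" if "y \<in> \<phi> ` (U \<inter> f -` V)" for y
      using that UA eq chart_inv[OF charted_chart[OF A U]] by auto
  qed
  ultimately show "Ck_on k (\<phi> ` (U \<inter> g -` V)) (\<psi> \<circ> g \<circ> inv_into U \<phi>)" by simp
qed

text \<open>The image of a chart of \<open>A\<close> need not lie in a single chart of
  \<open>B\<close>. Around each point an intermediate chart is chosen, and
  \<open>Ck_on_local\<close> assembles the local statements.\<close>

lemma Ck_map_compose:
  assumes A: "charted A" and B: "charted B" and C: "charted C"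
    and f: "Ck_map k A B f" and g: "Ck_map k B C g"
  shows "Ck_map k A C (g \<circ> f)"
proof (rule Ck_mapI)
  show cont: "continuous_map (mtop A) (mtop C) (g \<circ> f)"
    using f g by (auto simp: Ck_map_def intro: continuous_map_compose)
  fix U \<phi> V \<psi> assume U: "(U, \<phi>) \<in> atlas A" and V: "(V, \<psi>) \<in> atlas C"
  show "Ck_on k (\<phi> ` (U \<inter> (g \<circ> f) -` V)) (\<psi> \<circ> (g \<circ> f) \<circ> inv_into U \<phi>)"
  proof (rule Ck_on_local)
    fix y assume "y \<in> \<phi> ` (U \<inter> (g \<circ> f) -` V)"
    then obtain x where x: "x \<in> U" "g (f x) \<in> V" "y = \<phi> x" by auto
    have "f x \<in> topspace (mtop B)"
      using f x(1) chart_subset[OF charted_chart[OF A U]]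
      by (auto simp: Ck_map_def continuous_map_def)
    then obtain Y \<xi> where Y: "(Y, \<xi>) \<in> atlas B" "f x \<in> Y"
      by (rule charted_obtain[OF B])
    \<comment> \<open>\<open>P\<close> is the part of the intermediate chart that \<open>g\<close>
      sends into the target chart, and \<open>T\<close> below is the set of coordinates of points
      sent into \<open>P\<close> by \<open>f\<close>; on \<open>T\<close> the chart expressions of
      the two maps compose.\<close>
    define P where "P = Y \<inter> g -` V"
    have P: "openin (mtop B) P"
      unfolding P_def by (rule Ck_map_open_preimage(1)[OF B C g Y(1) charted_openin[OF C V]])
    define T where "T = \<phi> ` (U \<inter> f -` P)"
    have T: "open T"
      unfolding T_def by (rule Ck_map_open_preimage(2)[OF A B f U P])
    have f': "Ck_on k T (\<xi> \<circ> f \<circ> inv_into U \<phi>)"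
      by (rule Ck_on_subset[of _ "\<phi> ` (U \<inter> f -` Y)"])
        (use f U Y(1) in \<open>auto simp: Ck_map_def T_def P_def\<close>)
    have g': "Ck_on k (\<xi> ` P) (\<psi> \<circ> g \<circ> inv_into Y \<xi>)"
      using g V Y(1) by (auto simp: Ck_map_def P_def)
    have "(\<xi> \<circ> f \<circ> inv_into U \<phi>) ` T \<subseteq> \<xi> ` P"
      using chart_inv[OF charted_chart[OF A U]] by (auto simp: T_def)
    from Ck_on_compose[OF T f' g' this]
    have "Ck_on k T ((\<psi> \<circ> g \<circ> inv_into Y \<xi>) \<circ> (\<xi> \<circ> f \<circ> inv_into U \<phi>))" .
    moreover have "Ck_on k T ((\<psi> \<circ> g \<circ> inv_into Y \<xi>) \<circ> (\<xi> \<circ> f \<circ> inv_into U \<phi>))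
        \<longleftrightarrow> Ck_on k T (\<psi> \<circ> (g \<circ> f) \<circ> inv_into U \<phi>)"
      using chart_inv[OF charted_chart[OF A U]] chart_inv[OF charted_chart[OF B Y(1)]]
      by (intro Ck_on_cong T) (auto simp: T_def P_def)
    ultimately show "\<exists>T. open T \<and> y \<in> T \<and> Ck_on k T (\<psi> \<circ> (g \<circ> f) \<circ> inv_into U \<phi>)"
      using T x Y(2) by (intro exI[of _ T]) (auto simp: T_def P_def)
  qed
qed

lemma Ck_diffeo_compose:
  assumes A: "charted A" and B: "charted B" and C: "charted C"
    and f: "Ck_diffeo k A B f" and g: "Ck_diffeo k B C g"
  shows "Ck_diffeo k A C (g \<circ> f)"
proof -
  let ?f' = "inv_into (topspace (mtop A)) f" and ?g' = "inv_into (topspace (mtop B)) g"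
  have bij: "bij_betw f (topspace (mtop A)) (topspace (mtop B))"
    "bij_betw g (topspace (mtop B)) (topspace (mtop C))"
    using f g by (auto simp: Ck_diffeo_def)
  then have bij': "bij_betw (g \<circ> f) (topspace (mtop A)) (topspace (mtop C))"
    by (rule bij_betw_trans)
  \<comment> \<open>\<open>inv_into\<close> is arbitrary outside the image, so the two inverses are
    compared only on the space of \<open>C\<close>; \<open>Ck_map_cong\<close> accepts this.\<close>
  have inv: "(?f' \<circ> ?g') z = inv_into (topspace (mtop A)) (g \<circ> f) z" if "z \<in> topspace (mtop C)" for z
  proof (rule inv_into_f_eq[symmetric])
    show "inj_on (g \<circ> f) (topspace (mtop A))" using bij' by (rule bij_betw_imp_inj_on)
    have "?g' z \<in> topspace (mtop B)" "g (?g' z) = z"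
      using bij(2) that by (metis bij_betw_def inv_into_into, metis bij_betw_inv_into_right)
    then show "(?f' \<circ> ?g') z \<in> topspace (mtop A)" "(g \<circ> f) ((?f' \<circ> ?g') z) = z"
      using bij(1) by (metis bij_betw_def comp_apply inv_into_into,
        metis bij_betw_inv_into_right comp_apply)
  qed
  have "Ck_map k C A (?f' \<circ> ?g')"
    using f g by (auto simp: Ck_diffeo_def intro: Ck_map_compose[OF C B A])
  then have "Ck_map k C A (inv_into (topspace (mtop A)) (g \<circ> f))"
    using inv by (rule Ck_map_cong[OF C A])
  then show ?thesis
    using f g bij' by (auto simp: Ck_diffeo_def intro: Ck_map_compose[OF A B C])
qed

lemma Ck_diffeo_inverse:
  assumes "charted A" "charted B" "Ck_diffeo k A B f"
  shows "Ck_diffeo k B A (inv_into (topspace (mtop A)) f)"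
proof -
  let ?f' = "inv_into (topspace (mtop A)) f"
  have bij: "bij_betw f (topspace (mtop A)) (topspace (mtop B))"
    using assms(3) by (simp add: Ck_diffeo_def)
  have bij': "bij_betw ?f' (topspace (mtop B)) (topspace (mtop A))"
    using bij by (rule bij_betw_inv_into)
  have "Ck_map k A B (inv_into (topspace (mtop B)) ?f')"
    by (rule Ck_map_cong[OF assms(1,2), of k f])
      (use assms(3) bij in \<open>auto simp: Ck_diffeo_def inv_into_inv_into_eq\<close>)
  with assms(3) bij' show ?thesis by (simp add: Ck_diffeo_def)
qed

section \<open>Open submanifolds and restriction of diffeomorphisms\<close>

lemma topspace_open_submfd [simp]: "topspace (mtop (open_submfd M W)) = topspace (mtop M) \<inter> W"
  by (simp add: open_submfd_def)

lemma open_submfd_euclid: "open_submfd (euclid S) T = euclid (S \<inter> T)"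
  by (simp add: open_submfd_def euclid_def subtopology_subtopology)

lemma topspace_euclid [simp]: "topspace (mtop (euclid S)) = S"
  by (simp add: euclid_def)

lemma charted_euclid: "open S \<Longrightarrow> charted (euclid S)"
  by (simp add: charted_def euclid_def chart_on_def homeomorphic_map_id[unfolded id_def] subtopology_subtopology)

lemma chart_on_restrict:
  assumes "chart_on X U \<phi>" "openin X W"
  shows "chart_on (subtopology X W) (U \<inter> W) \<phi>"
proof -
  have U: "openin X (U \<inter> W)" using assms by (simp add: chart_on_def openin_Int)
  have "homeomorphic_map (subtopology X U) (top_of_set (\<phi> ` U)) \<phi>"
    using assms(1) by (simp add: chart_on_def)
  then have "homeomorphic_map (subtopology (subtopology X U) (U \<inter> W))
      (subtopology (top_of_set (\<phi> ` U)) (\<phi> ` (U \<inter> W))) \<phi>"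
    using chart_subset[OF assms(1)] chart_inj[OF assms(1)]
    by (elim homeomorphic_map_subtopologies) (auto simp: inj_on_def)
  then have "homeomorphic_map (subtopology X (U \<inter> W)) (top_of_set (\<phi> ` (U \<inter> W))) \<phi>"
    by (simp add: subtopology_subtopology Int_absorb1 image_mono)
  then show ?thesis
    using chart_open_image[OF assms(1) U] U
    by (simp add: chart_on_def subtopology_subtopology openin_subtopology Int_absorb1)
      (metis inf_assoc inf_idem)
qed

lemma charted_open_submfd:
  assumes "charted M" "openin (mtop M) W"
  shows "charted (open_submfd M W)"
proof -
  have "(\<Union>(U, \<phi>)\<in>atlas (open_submfd M W). U) = (\<Union>(U, \<phi>)\<in>atlas M. U) \<inter> W"
    by (auto simp: open_submfd_def)
  then show ?thesis
    using assms by (auto simp: charted_def open_submfd_def intro: chart_on_restrict)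
qed

lemma Ck_map_restrict:
  assumes A: "charted A" and B: "charted B" and f: "Ck_map k A B f"
    and P: "openin (mtop A) P" and Q: "openin (mtop B) Q" and PQ: "f ` P \<subseteq> Q"
  shows "Ck_map k (open_submfd A P) (open_submfd B Q) f"
proof (rule Ck_mapI)
  show "continuous_map (mtop (open_submfd A P)) (mtop (open_submfd B Q)) f"
    using f PQ by (auto simp: Ck_map_def open_submfd_def continuous_map_in_subtopology
        intro: continuous_map_from_subtopology)
  fix U' \<phi> V' \<psi>
  assume "(U', \<phi>) \<in> atlas (open_submfd A P)" "(V', \<psi>) \<in> atlas (open_submfd B Q)"
  then obtain U V where U: "(U, \<phi>) \<in> atlas A" "U' = U \<inter> P" and V: "(V, \<psi>) \<in> atlas B" "V' = V \<inter> Q"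
    by (auto simp: open_submfd_def)
  have cU: "chart_on (mtop A) U \<phi>" using A U(1) by (rule charted_chart)
  have eq: "U' \<inter> f -` V' = U \<inter> f -` V \<inter> P" using U V PQ by auto
  have "openin (mtop A) (U \<inter> f -` V \<inter> P)"
    using Ck_map_open_preimage(1)[OF A B f U(1) charted_openin[OF B V(1)]] P by (rule openin_Int)
  then have op: "open (\<phi> ` (U' \<inter> f -` V'))"
    unfolding eq by (rule chart_open_image[OF cU]) auto
  have "Ck_on k (\<phi> ` (U \<inter> f -` V)) (\<psi> \<circ> f \<circ> inv_into U \<phi>)"
    using f U V by (auto simp: Ck_map_def)
  then have "Ck_on k (\<phi> ` (U' \<inter> f -` V')) (\<psi> \<circ> f \<circ> inv_into U \<phi>)"
    unfolding eq by (rule Ck_on_subset) auto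
  moreover have "inv_into U' \<phi> (\<phi> x) = inv_into U \<phi> (\<phi> x)" if "x \<in> U'" for x
    using chart_inj[OF cU] that U(2) inj_on_subset[of \<phi> U U'] by (simp add: inv_into_f_f)
  then have "Ck_on k (\<phi> ` (U' \<inter> f -` V')) (\<psi> \<circ> f \<circ> inv_into U' \<phi>)
      \<longleftrightarrow> Ck_on k (\<phi> ` (U' \<inter> f -` V')) (\<psi> \<circ> f \<circ> inv_into U \<phi>)"
    by (intro Ck_on_cong op) auto
  ultimately show "Ck_on k (\<phi> ` (U' \<inter> f -` V')) (\<psi> \<circ> f \<circ> inv_into U' \<phi>)" by simp
qed

lemma Ck_diffeo_open_image:
  assumes "Ck_diffeo k A B f" "openin (mtop A) P"
  shows "openin (mtop B) (f ` P)"
proof -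
  let ?f' = "inv_into (topspace (mtop A)) f"
  have bij: "bij_betw f (topspace (mtop A)) (topspace (mtop B))"
    using assms(1) by (simp add: Ck_diffeo_def)
  have "openin (mtop B) {y \<in> topspace (mtop B). ?f' y \<in> P}"
    using assms by (auto simp: Ck_diffeo_def Ck_map_def intro: openin_continuous_map_preimage)
  also have "{y \<in> topspace (mtop B). ?f' y \<in> P} = f ` P"
  proof (intro equalityI subsetI)
    fix y assume "y \<in> {y \<in> topspace (mtop B). ?f' y \<in> P}"
    then show "y \<in> f ` P" using bij_betw_inv_into_right[OF bij] by (metis (mono_tags) image_eqI mem_Collect_eq)
  next
    fix y assume "y \<in> f ` P"
    then show "y \<in> {y \<in> topspace (mtop B). ?f' y \<in> P}"
      using bij_betw_inv_into_left[OF bij] openin_subset[OF assms(2)] bij_betwE[OF bij] by auto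
  qed
  finally show ?thesis .
qed

lemma Ck_diffeo_restrict:
  assumes A: "charted A" and B: "charted B" and f: "Ck_diffeo k A B f" and P: "openin (mtop A) P"
  shows "Ck_diffeo k (open_submfd A P) (open_submfd B (f ` P)) f"
proof -
  let ?f' = "inv_into (topspace (mtop A)) f"
  have fP: "openin (mtop B) (f ` P)" using f P by (rule Ck_diffeo_open_image)
  have bij: "bij_betw f (topspace (mtop A)) (topspace (mtop B))"
    using f by (simp add: Ck_diffeo_def)
  have PA: "P \<subseteq> topspace (mtop A)" "f ` P \<subseteq> topspace (mtop B)"
    using P fP openin_subset by blast+
  have bijP: "bij_betw f P (f ` P)"
    using bij_betw_subset[OF bij PA(1)] by simp
  have inv: "?f' y = inv_into P f y" if "y \<in> f ` P" for y
    using that bij PA(1) bijP by (auto simp: bij_betw_def inv_into_f_f subset_iff)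
  have "Ck_map k (open_submfd B (f ` P)) (open_submfd A P) ?f'"
    using f inv bijP
    by (intro Ck_map_restrict B A fP P) (auto simp: Ck_diffeo_def bij_betw_def inv_into_f_f)
  then have "Ck_map k (open_submfd B (f ` P)) (open_submfd A P) (inv_into P f)"
    by (rule Ck_map_cong[rotated 2])
      (use inv charted_open_submfd[OF A P] charted_open_submfd[OF B fP] in auto)
  moreover have "Ck_map k (open_submfd A P) (open_submfd B (f ` P)) f"
    using f by (intro Ck_map_restrict A B P fP) (auto simp: Ck_diffeo_def)
  ultimately show ?thesis
    using bijP PA by (simp add: Ck_diffeo_def Int_absorb1)
qed

lemma Ck_diffeo_shift: "Ck_diffeo k (euclid UNIV) (euclid UNIV) (\<lambda>x. x + s)"
proof -
  have map: "Ck_map k (euclid UNIV) (euclid UNIV) (\<lambda>x. x + r)" for r :: 'a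
  proof -
    have "continuous_map euclidean euclidean (\<lambda>x. x + r)"
      by (auto intro!: continuous_intros simp: continuous_map_iff_continuous2)
    moreover have "Ck_on k UNIV (\<lambda>x. x + r)"
      by (rule Ck_on_add[OF open_UNIV Ck_on_ident Ck_on_const])
    moreover have "inv_into UNIV (\<lambda>x::'a. x) = (\<lambda>x. x)" by (simp flip: id_def)
    ultimately show ?thesis by (simp add: Ck_map_def euclid_def o_def)
  qed
  have "inv_into UNIV (\<lambda>x. x + s) = (\<lambda>x. x + (- s))"
    by (intro inv_equality) auto
  then have "Ck_map k (euclid UNIV) (euclid UNIV) (inv_into UNIV (\<lambda>x. x + s))"
    using map[of "- s"] by (simp only:)
  moreover have "bij (\<lambda>x. x + s)"
    by (rule o_bij[of "\<lambda>x. x - s"]) auto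
  ultimately show ?thesis using map by (simp add: Ck_diffeo_def)
qed

section \<open>Frames\<close>

text \<open>Keeps the parameter domain \<open>S\<close> visible and does not ask that it contain 0:
  translates of one representative are indexed by \<open>S\<close>, and a representative and its
  image under a diffeomorphism are compared over the same \<open>S\<close>.\<close>

definition frame_germ_on ::
  "nat \<Rightarrow> ('m, 'e::finite_dim_inner) mfd \<Rightarrow> 'e set \<Rightarrow> ('e \<Rightarrow> 'm) \<Rightarrow> bool" where
  "frame_germ_on k M S u \<longleftrightarrow>
     open S \<and> (\<exists>W. openin (mtop M) W \<and> Ck_diffeo k (euclid S) (open_submfd M W) u)"

lemma frame_germ_iff: "frame_germ k M u \<longleftrightarrow> (\<exists>S. 0 \<in> S \<and> frame_germ_on k M S u)"
  by (auto simp: frame_germ_def frame_germ_on_def)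

lemma frame_germ_onE:
  assumes "frame_germ_on k M S u"
  obtains "open S" "openin (mtop M) (u ` S)" "Ck_diffeo k (euclid S) (open_submfd M (u ` S)) u"
proof -
  obtain W where W: "openin (mtop M) W" "Ck_diffeo k (euclid S) (open_submfd M W) u"
    using assms by (auto simp: frame_germ_on_def)
  then have "u ` S = W"
    using openin_subset[OF W(1)] by (auto simp: Ck_diffeo_def bij_betw_def)
  with W assms show ?thesis by (intro that) (auto simp: frame_germ_on_def)
qed

lemma frame_germ_on_compose_left:
  assumes N: "charted N" and M: "charted M" and f: "Ck_diffeo k N M f"
    and u: "frame_germ_on k N S u"
  shows "frame_germ_on k M S (f \<circ> u)"
  using u
proof (rule frame_germ_onE)
  assume S: "open S" and uS: "openin (mtop N) (u ` S)"
    and u: "Ck_diffeo k (euclid S) (open_submfd N (u ` S)) u"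
  have fuS: "openin (mtop M) (f ` u ` S)" using f uS by (rule Ck_diffeo_open_image)
  have "Ck_diffeo k (euclid S) (open_submfd M (f ` u ` S)) (f \<circ> u)"
    by (rule Ck_diffeo_compose[OF charted_euclid[OF S] charted_open_submfd[OF N uS]
          charted_open_submfd[OF M fuS] u Ck_diffeo_restrict[OF N M f uS]])
  with S fuS show ?thesis by (auto simp: frame_germ_on_def)
qed

lemma frame_germ_on_compose_right:
  assumes M: "charted M" and a: "Ck_diffeo k (euclid UNIV) (euclid UNIV) a"
    and u: "frame_germ_on k M S u"
  shows "frame_germ_on k M (a -` S) (u \<circ> a)"
  using u
proof (rule frame_germ_onE)
  assume S: "open S" and uS: "openin (mtop M) (u ` S)"
    and u: "Ck_diffeo k (euclid S) (open_submfd M (u ` S)) u"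
  have "continuous_map euclidean euclidean a"
    using a by (simp add: Ck_diffeo_def Ck_map_def euclid_def)
  then have aS: "open (a -` S)"
    using S by (simp add: continuous_map_iff_continuous2 open_vimage)
  have "surj a" using a by (simp add: Ck_diffeo_def bij_betw_def)
  then have im: "a ` (a -` S) = S" by simp
  have E: "charted (euclid (UNIV :: 'b set))" by (rule charted_euclid) simp
  have "openin (mtop (euclid UNIV)) (a -` S)"
    using aS by (simp add: euclid_def)
  from Ck_diffeo_restrict[OF E E a this]
  have "Ck_diffeo k (euclid (a -` S)) (euclid S) a"
    by (simp add: im open_submfd_euclid del: image_vimage_eq)
  from Ck_diffeo_compose[OF charted_euclid[OF aS] charted_euclid[OF S]
      charted_open_submfd[OF M uS] this u]
  show ?thesis using aS uS by (auto simp: frame_germ_on_def)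
qed

lemma frame_germ_compose_left:
  "charted N \<Longrightarrow> charted M \<Longrightarrow> Ck_diffeo k N M f \<Longrightarrow> frame_germ k N u \<Longrightarrow> frame_germ k M (f \<circ> u)"
  unfolding frame_germ_iff using frame_germ_on_compose_left by blast

lemma frame_germ_compose_right:
  assumes "charted M" "a \<in> origin_diffeos" "frame_germ k M u"
  shows "frame_germ k M (u \<circ> a)"
proof -
  obtain S where S: "0 \<in> S" "frame_germ_on k M S u"
    using assms(3) by (auto simp: frame_germ_iff)
  have "Ck_diffeo k (euclid UNIV) (euclid UNIV) a" "a 0 = 0"
    using assms(2) by (auto simp: origin_diffeos_def smooth_diffeo_def)
  then show ?thesis
    using frame_germ_on_compose_right[OF assms(1) _ S(2)] S(1)
    by (auto simp: frame_germ_iff intro!: exI[of _ "a -` S"])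
qed

text \<open>Translation does not fix the origin. The parameter domain becomes the preimage of
  \<open>S\<close>, which contains 0 because \<open>s\<close> lies in \<open>S\<close>.\<close>

lemma frame_germ_shift:
  assumes "charted M" "frame_germ_on k M S u" "s \<in> S"
  shows "frame_germ k M (\<lambda>x. u (x + s))"
  using frame_germ_on_compose_right[OF assms(1) Ck_diffeo_shift assms(2)] assms(3)
  by (auto simp: frame_germ_iff o_def intro!: exI[of _ "(\<lambda>x. x + s) -` S"])

lemma frame_germ_on_image_subset:
  "frame_germ_on k M S u \<Longrightarrow> u ` S \<subseteq> topspace (mtop M)"
  by (erule frame_germ_onE) (rule openin_subset)

lemma frame_germ_value: "frame_germ k M u \<Longrightarrow> u 0 \<in> topspace (mtop M)"
  using frame_germ_on_image_subset by (fastforce simp: frame_germ_iff)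

lemma frame_germ_on_open_image:
  assumes "charted M" "frame_germ_on k M S u" "open T" "T \<subseteq> S"
  shows "openin (mtop M) (u ` T)"
  using assms(2)
proof (rule frame_germ_onE)
  assume S: "open S" and uS: "openin (mtop M) (u ` S)"
    and u: "Ck_diffeo k (euclid S) (open_submfd M (u ` S)) u"
  have "openin (mtop (euclid S)) T"
    using assms(3,4) by (simp add: euclid_def openin_open_eq S)
  from Ck_diffeo_open_image[OF u this] uS show ?thesis
    by (auto simp: open_submfd_def intro: openin_trans_full)
qed

lemma frame_germ_on_chart:
  assumes "charted M" "frame_germ_on k M S u" "(U, \<phi>) \<in> atlas M"
  shows "open (S \<inter> u -` U)" and "Ck_on k (S \<inter> u -` U) (\<phi> \<circ> u)"
proof -
  have "open (S \<inter> u -` U) \<and> Ck_on k (S \<inter> u -` U) (\<phi> \<circ> u)"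
    using assms(2)
  proof (rule frame_germ_onE)
    assume S: "open S" and uS: "openin (mtop M) (u ` S)"
      and u: "Ck_diffeo k (euclid S) (open_submfd M (u ` S)) u"
    have map: "Ck_map k (euclid S) (open_submfd M (u ` S)) u"
      using u by (simp add: Ck_diffeo_def)
    have at: "(S, \<lambda>x. x) \<in> atlas (euclid S)" by (simp add: euclid_def)
    have U: "(U \<inter> u ` S, \<phi>) \<in> atlas (open_submfd M (u ` S))"
      using assms(3) by (force simp: open_submfd_def)
    have eq: "(\<lambda>x. x) ` (S \<inter> u -` (U \<inter> u ` S)) = S \<inter> u -` U" by auto
    have op: "open (S \<inter> u -` U)"
      using Ck_map_open_preimage(2)[OF charted_euclid[OF S] charted_open_submfd[OF assms(1) uS]
          map at charted_openin[OF charted_open_submfd[OF assms(1) uS] U]]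
      unfolding eq .
    have inv: "inv_into S (\<lambda>x. x) x = x" if "x \<in> S" for x
      using that by (intro inv_into_f_eq) auto
    have "Ck_on k (S \<inter> u -` U) (\<phi> \<circ> u \<circ> inv_into S (\<lambda>x. x))"
      using map at U unfolding Ck_map_def eq[symmetric] by blast
    then have "Ck_on k (S \<inter> u -` U) (\<phi> \<circ> u)"
      by (rule iffD1[OF Ck_on_cong[OF op], rotated]) (simp add: inv)
    with op show ?thesis ..
  qed
  then show "open (S \<inter> u -` U)" "Ck_on k (S \<inter> u -` U) (\<phi> \<circ> u)" by auto
qed

lemma frame_germ_Ck_near:
  assumes "charted M" "frame_germ k M u" "(U, \<phi>) \<in> atlas M" "u 0 \<in> U"
  shows "Ck_near k (\<phi> \<circ> u)" and "\<forall>\<^sub>F x in nhds 0. u x \<in> U"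
proof -
  obtain S where S: "0 \<in> S" "frame_germ_on k M S u"
    using assms(2) by (auto simp: frame_germ_iff)
  note chart = frame_germ_on_chart[OF assms(1) S(2) assms(3)]
  show "Ck_near k (\<phi> \<circ> u)"
    unfolding Ck_near_def using chart S(1) assms(4) by (intro exI[of _ "S \<inter> u -` U"]) auto
  show "\<forall>\<^sub>F x in nhds 0. u x \<in> U"
    unfolding eventually_nhds using chart(1) S(1) assms(4) by (intro exI[of _ "S \<inter> u -` U"]) auto
qed

section \<open>Equality of frames and the induced map on frames\<close>

lemma frame_jet_eqI:
  assumes "u 0 = w 0"
    and "\<And>U \<phi>. (U, \<phi>) \<in> atlas M \<Longrightarrow> w 0 \<in> U \<Longrightarrow> jet0 k (\<phi> \<circ> u) = jet0 k (\<phi> \<circ> w)"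
  shows "frame_jet k M u = frame_jet k M w"
  unfolding frame_jet_def using assms by auto

lemma frame_jet_refl: "frame_germ k M u \<Longrightarrow> u \<in> frame_jet k M u"
  by (auto simp: frame_jet_def)

text \<open>A germ belongs to its own jet, so equality of the two sets puts \<open>w\<close> into
  the jet of \<open>u\<close>, whose defining conditions are the claims.\<close>

lemma frame_jet_eqD:
  assumes "frame_germ k M w" "frame_jet k M u = frame_jet k M w"
  shows "w 0 = u 0" and "(U, \<phi>) \<in> atlas M \<Longrightarrow> u 0 \<in> U \<Longrightarrow> jet0 k (\<phi> \<circ> w) = jet0 k (\<phi> \<circ> u)"
proof -
  have "w \<in> frame_jet k M u" using frame_jet_refl[OF assms(1)] assms(2) by simp
  then show "w 0 = u 0" "(U, \<phi>) \<in> atlas M \<Longrightarrow> u 0 \<in> U \<Longrightarrow> jet0 k (\<phi> \<circ> w) = jet0 k (\<phi> \<circ> u)"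
    by (auto simp: frame_jet_def)
qed

lemma frame_jet_eventually_eq:
  assumes "\<forall>\<^sub>F x in nhds 0. u x = w x"
  shows "frame_jet k M u = frame_jet k M w"
proof (rule frame_jet_eqI)
  show "u 0 = w 0" using assms by (rule eventually_nhds_x_imp_x)
  show "jet0 k (\<phi> \<circ> u) = jet0 k (\<phi> \<circ> w)" for \<phi> :: "'b \<Rightarrow> 'a"
    by (rule jet0_eventually_eq) (use assms in \<open>auto elim: eventually_mono\<close>)
qed

lemma frame_germ_chart_compose:
  assumes "charted N" "frame_germ k N u" "(U, \<phi>) \<in> atlas N" "u 0 \<in> U"
  shows "\<forall>\<^sub>F x in nhds 0. (\<psi> \<circ> (f \<circ> u)) x = ((\<psi> \<circ> f \<circ> inv_into U \<phi>) \<circ> (\<phi> \<circ> u)) x"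
  using frame_germ_Ck_near(2)[OF assms]
  by eventually_elim (simp add: chart_inv[OF charted_chart[OF assms(1,3)]])

text \<open>Near 0 the chart expression of \<open>f \<circ> w t\<close> is one fixed C^k map between
  vector spaces applied to \<open>\<phi> \<circ> w t\<close>, which is the situation of
  \<open>jets_tendsto_compose\<close>.\<close>

lemma jets_tendsto_frame:
  assumes N: "charted N" and M: "charted M" and f: "Ck_map k N M f"
    and U: "(U, \<phi>) \<in> atlas N" and V: "(V, \<psi>) \<in> atlas M"
    and w: "\<forall>\<^sub>F t in F. frame_germ k N (w t) \<and> w t 0 \<in> U"
    and u: "frame_germ k N u" "u 0 \<in> U" "f (u 0) \<in> V"
    and lim: "jets_tendsto k (\<lambda>t. \<phi> \<circ> w t) (\<phi> \<circ> u) F"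
  shows "jets_tendsto k (\<lambda>t. \<psi> \<circ> (f \<circ> w t)) (\<psi> \<circ> (f \<circ> u)) F"
    and "\<forall>\<^sub>F t in F. f (w t 0) \<in> V"
proof -
  let ?T = "\<phi> ` (U \<inter> f -` V)"
  have T: "open ?T"
    using Ck_map_open_preimage(2)[OF N M f U charted_openin[OF M V]] .
  have g: "Ck_on k ?T (\<psi> \<circ> f \<circ> inv_into U \<phi>)"
    using f U V by (auto simp: Ck_map_def)
  have near: "\<forall>\<^sub>F t in F. Ck_near k (\<phi> \<circ> w t)"
    using w by eventually_elim (use frame_germ_Ck_near(1)[OF N _ U] in blast)
  have u0: "(\<phi> \<circ> u) 0 \<in> ?T" using u by auto
  have "jets_tendsto k (\<lambda>t. (\<psi> \<circ> f \<circ> inv_into U \<phi>) \<circ> (\<phi> \<circ> w t))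
      ((\<psi> \<circ> f \<circ> inv_into U \<phi>) \<circ> (\<phi> \<circ> u)) F"
    by (rule jets_tendsto_compose[OF T lim near frame_germ_Ck_near(1)[OF N u(1) U u(2)] g u0])
  moreover have "\<forall>\<^sub>F t in F. \<forall>\<^sub>F x in nhds 0.
      (\<psi> \<circ> (f \<circ> w t)) x = ((\<psi> \<circ> f \<circ> inv_into U \<phi>) \<circ> (\<phi> \<circ> w t)) x"
    using w by eventually_elim (use frame_germ_chart_compose[OF N _ U] in blast)
  ultimately show "jets_tendsto k (\<lambda>t. \<psi> \<circ> (f \<circ> w t)) (\<psi> \<circ> (f \<circ> u)) F"
    using frame_germ_chart_compose[OF N u(1) U u(2)] by (rule jets_tendsto_cong[rotated 2])
  \<comment> \<open>The order 0 part of the convergence brings the coordinates of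
    \<open>w t 0\<close> into the open set \<open>?T\<close>; injectivity of the chart carries this
    back to \<open>N\<close>.\<close>
  have "\<forall>\<^sub>F t in F. (\<phi> \<circ> w t) 0 \<in> ?T"
    using jets_tendsto_value[OF lim] T u0 by (rule topological_tendstoD)
  with w show "\<forall>\<^sub>F t in F. f (w t 0) \<in> V"
  proof eventually_elim
    case (elim t)
    then obtain x where "x \<in> U" "f x \<in> V" "\<phi> (w t 0) = \<phi> x" "w t 0 \<in> U" by auto
    then show ?case
      using chart_inj[OF charted_chart[OF N U]] by (auto dest: inj_onD)
  qed
qed

text \<open>Constant families turn continuity of composition into equality of jets. One chart at
  \<open>u 0\<close> suffices in \<open>N\<close>, while the conclusion is obtained for every chart
  of \<open>M\<close> at the image point.\<close>

lemma frame_jet_compose_eq: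
  assumes N: "charted N" and M: "charted M" and f: "Ck_map k N M f"
    and w: "frame_germ k N w" and u: "frame_germ k N u"
    and eq: "frame_jet k N u = frame_jet k N w"
  shows "frame_jet k M (f \<circ> w) = frame_jet k M (f \<circ> u)"
proof (rule frame_jet_eqI)
  have w0: "w 0 = u 0" by (rule frame_jet_eqD(1)[OF w eq])
  then show "(f \<circ> w) 0 = (f \<circ> u) 0" by simp
  fix V \<psi> assume V: "(V, \<psi>) \<in> atlas M" "(f \<circ> u) 0 \<in> V"
  obtain U \<phi> where U: "(U, \<phi>) \<in> atlas N" "u 0 \<in> U"
    using charted_obtain[OF N frame_germ_value[OF u]] by blast
  have "jet0 k (\<phi> \<circ> w) = jet0 k (\<phi> \<circ> u)"
    by (rule frame_jet_eqD(2)[OF w eq U])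
  then have "jets_tendsto k (\<lambda>_::nat. \<phi> \<circ> w) (\<phi> \<circ> u) sequentially"
    by (simp add: jets_tendsto_const_iff)
  then have "jets_tendsto k (\<lambda>_::nat. \<psi> \<circ> (f \<circ> w)) (\<psi> \<circ> (f \<circ> u)) sequentially"
    using U V w u w0 by (intro jets_tendsto_frame(1)[OF N M f U(1) V(1)]) auto
  then show "jet0 k (\<psi> \<circ> (f \<circ> w)) = jet0 k (\<psi> \<circ> (f \<circ> u))"
    by (simp add: jets_tendsto_const_iff)
qed

text \<open>All members of the union defining \<open>frame_map\<close> coincide by
  \<open>frame_jet_compose_eq\<close>, and the union is nonempty because \<open>u\<close> represents
  its own jet.\<close>

lemma frame_map_frame_jet:
  assumes N: "charted N" and M: "charted M" and f: "Ck_map k N M f" and u: "frame_germ k N u"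
  shows "frame_map k M f (frame_jet k N u) = frame_jet k M (f \<circ> u)"
proof -
  have "frame_jet k M (f \<circ> w) = frame_jet k M (f \<circ> u)" if "w \<in> frame_jet k N u" for w
  proof -
    have w: "frame_germ k N w" "w 0 = u 0"
      "\<And>U \<phi>. (U, \<phi>) \<in> atlas N \<Longrightarrow> u 0 \<in> U \<Longrightarrow> jet0 k (\<phi> \<circ> w) = jet0 k (\<phi> \<circ> u)"
      using that by (auto simp: frame_jet_def)
    have "frame_jet k N u = frame_jet k N w"
      using w by (intro frame_jet_eqI) auto
    then show ?thesis by (rule frame_jet_compose_eq[OF N M f w(1) u])
  qed
  then show ?thesis
    using frame_jet_refl[OF u] unfolding frame_map_def by blast
qed

section \<open>The topology of the frame bundle\<close>

definition frame_basic_open ::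
  "nat \<Rightarrow> ('m, 'e::finite_dim_inner) mfd \<Rightarrow> 'm set \<Rightarrow> ('m \<Rightarrow> 'e) \<Rightarrow> ('e list \<Rightarrow> 'e) set \<Rightarrow>
   ('e \<Rightarrow> 'm) set set" where
  "frame_basic_open k M U \<phi> Q =
     {frame_jet k M u | u. frame_germ k M u \<and> u 0 \<in> U \<and> jet0 k (\<phi> \<circ> u) \<in> Q}"

lemma frame_topology_eq:
  "frame_topology k M =
     topology_generated_by {frame_basic_open k M U \<phi> Q | U \<phi> Q. (U, \<phi>) \<in> atlas M \<and> open Q}"
  by (simp add: frame_topology_def frame_basic_open_def)

text \<open>A basic set only demands some suitable representative. Since equal frames have equal
  jets in every chart at the base point, the test can be made on any given one.\<close>

lemma frame_jet_in_basic_open_iff: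
  assumes "(U, \<phi>) \<in> atlas M" "frame_germ k M u"
  shows "frame_jet k M u \<in> frame_basic_open k M U \<phi> Q \<longleftrightarrow> u 0 \<in> U \<and> jet0 k (\<phi> \<circ> u) \<in> Q"
proof
  assume "frame_jet k M u \<in> frame_basic_open k M U \<phi> Q"
  then obtain w where w: "frame_germ k M w" "w 0 \<in> U" "jet0 k (\<phi> \<circ> w) \<in> Q"
    "frame_jet k M u = frame_jet k M w"
    by (auto simp: frame_basic_open_def)
  then have "w 0 = u 0" by (intro frame_jet_eqD(1))
  with w frame_jet_eqD(2)[OF w(1,4) assms(1)] show "u 0 \<in> U \<and> jet0 k (\<phi> \<circ> u) \<in> Q" by auto
next
  assume "u 0 \<in> U \<and> jet0 k (\<phi> \<circ> u) \<in> Q"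
  with assms(2) show "frame_jet k M u \<in> frame_basic_open k M U \<phi> Q"
    unfolding frame_basic_open_def by blast
qed

lemma topspace_frame_topology:
  assumes "charted M"
  shows "topspace (frame_topology k M) = frame_bundle k M"
proof (intro equalityI subsetI)
  fix p assume "p \<in> topspace (frame_topology k M)"
  then show "p \<in> frame_bundle k M"
    by (auto simp: frame_topology_eq frame_basic_open_def frame_bundle_def)
next
  fix p assume "p \<in> frame_bundle k M"
  then obtain u where u: "frame_germ k M u" "p = frame_jet k M u"
    by (auto simp: frame_bundle_def)
  obtain U \<phi> where U: "(U, \<phi>) \<in> atlas M" "u 0 \<in> U"
    using charted_obtain[OF assms frame_germ_value[OF u(1)]] by blast
  then have "p \<in> frame_basic_open k M U \<phi> UNIV"
    using frame_jet_in_basic_open_iff[OF U(1) u(1)] u(2) by auto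
  then show "p \<in> topspace (frame_topology k M)"
    using U(1) open_UNIV unfolding frame_topology_eq topology_generated_by_topspace by blast
qed

text \<open>Eventual membership passes to finite intersections and to unions, so checking the
  generators is enough.\<close>

lemma limitin_topology_generated_by:
  assumes "l \<in> \<Union>\<S>" "\<And>U. U \<in> \<S> \<Longrightarrow> l \<in> U \<Longrightarrow> \<forall>\<^sub>F t in F. f t \<in> U"
  shows "limitin (topology_generated_by \<S>) f l F"
  unfolding limitin_def
proof (intro conjI allI impI)
  show "l \<in> topspace (topology_generated_by \<S>)" using assms(1) by simp
  fix U assume "openin (topology_generated_by \<S>) U \<and> l \<in> U"
  then have "generate_topology_on \<S> U" "l \<in> U"
    by (auto simp: openin_topology_generated_by_iff)
  then show "\<forall>\<^sub>F t in F. f t \<in> U"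
  proof induction
    case (Int a b)
    then show ?case by (auto intro: eventually_conj)
  next
    case (UN K)
    then obtain A where "A \<in> K" "l \<in> A" by auto
    with UN.IH have "\<forall>\<^sub>F t in F. f t \<in> A" by blast
    with \<open>A \<in> K\<close> show ?case by (auto elim: eventually_mono)
  qed (use assms(2) in auto)
qed

text \<open>
  The derivatives at 0 of \<open>x \<mapsto> u (x + s)\<close> are those of \<open>u\<close> at \<open>s\<close>: translates approximate a frame by
  frames over nearby points, which makes the frames over a dense set of points dense.
\<close>

lemma limitin_frame_jet_shift:
  assumes M: "charted M" and u: "frame_germ_on k M S u" "0 \<in> S"
  shows "limitin (frame_topology k M) (\<lambda>s. frame_jet k M (\<lambda>x. u (x + s))) (frame_jet k M u) (nhds 0)"
  unfolding frame_topology_eq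
proof (rule limitin_topology_generated_by)
  have germ: "frame_germ k M u" using u by (auto simp: frame_germ_iff)
  then have "frame_jet k M u \<in> topspace (frame_topology k M)"
    by (auto simp: topspace_frame_topology[OF M] frame_bundle_def)
  then show "frame_jet k M u \<in> \<Union> {frame_basic_open k M U \<phi> Q | U \<phi> Q. (U, \<phi>) \<in> atlas M \<and> open Q}"
    unfolding frame_topology_eq topology_generated_by_topspace .
  fix O' assume "O' \<in> {frame_basic_open k M U \<phi> Q | U \<phi> Q. (U, \<phi>) \<in> atlas M \<and> open Q}"
    and "frame_jet k M u \<in> O'"
  then obtain U \<phi> Q where O': "O' = frame_basic_open k M U \<phi> Q" "(U, \<phi>) \<in> atlas M" "open Q"
    and uU: "u 0 \<in> U" "jet0 k (\<phi> \<circ> u) \<in> Q"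
    using frame_jet_in_basic_open_iff[OF _ germ] by auto
  have "jets_tendsto k (\<lambda>s x. (\<phi> \<circ> u) (x + s)) (\<phi> \<circ> u) (nhds 0)"
    by (rule jets_tendsto_shift[OF frame_germ_Ck_near(1)[OF M germ O'(2) uU(1)]])
  then have ev_Q: "\<forall>\<^sub>F s in nhds 0. jet0 k (\<lambda>x. (\<phi> \<circ> u) (x + s)) \<in> Q"
    using O'(3) uU(2) by (rule jets_tendsto_imp_tendsto_jet0)
  have "open S" using u(1) by (simp add: frame_germ_on_def)
  then have ev_S: "\<forall>\<^sub>F s in nhds 0. s \<in> S" using u(2) by (rule eventually_nhds_in_open)
  show "\<forall>\<^sub>F s in nhds 0. frame_jet k M (\<lambda>x. u (x + s)) \<in> O'"
    using ev_Q ev_S frame_germ_Ck_near(2)[OF M germ O'(2) uU(1)]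
  proof eventually_elim
    case (elim s)
    then show ?case
      using frame_jet_in_basic_open_iff[OF O'(2) frame_germ_shift[OF M u(1)], of s Q]
      by (simp add: O'(1) o_def)
  qed
qed

lemma continuous_map_frame_map:
  assumes N: "charted N" and M: "charted M" and f: "Ck_diffeo k N M f"
  shows "continuous_map (frame_topology k N) (frame_topology k M) (frame_map k M f)"
proof -
  have map: "Ck_map k N M f" using f by (simp add: Ck_diffeo_def)
  note fm = frame_map_frame_jet[OF N M map]
  note germ_f = frame_germ_compose_left[OF N M f]
  show ?thesis
    unfolding frame_topology_eq[of k M]
  proof (rule continuous_on_generated_topo)
    have "frame_map k M f ` topspace (frame_topology k N) \<subseteq> topspace (frame_topology k M)"
      using fm germ_f by (auto simp: topspace_frame_topology[OF M] topspace_frame_topology[OF N] frame_bundle_def)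
    then show "frame_map k M f ` topspace (frame_topology k N)
        \<subseteq> \<Union> {frame_basic_open k M U \<phi> Q | U \<phi> Q. (U, \<phi>) \<in> atlas M \<and> open Q}"
      unfolding frame_topology_eq[of k M] topology_generated_by_topspace .
  next
    fix O' assume "O' \<in> {frame_basic_open k M U \<phi> Q | U \<phi> Q. (U, \<phi>) \<in> atlas M \<and> open Q}"
    then obtain V \<psi> Q where O': "O' = frame_basic_open k M V \<psi> Q" and V: "(V, \<psi>) \<in> atlas M"
      and Q: "open Q" by blast
    show "openin (frame_topology k N) (frame_map k M f -` O' \<inter> topspace (frame_topology k N))"
    proof (subst openin_subopen, intro ballI)
      fix p assume p: "p \<in> frame_map k M f -` O' \<inter> topspace (frame_topology k N)"
      then obtain u where u: "frame_germ k N u" "p = frame_jet k N u"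
        by (auto simp: topspace_frame_topology[OF N] frame_bundle_def)
      have fu: "f (u 0) \<in> V" "jet0 k (\<psi> \<circ> (f \<circ> u)) \<in> Q"
        using p u fm frame_jet_in_basic_open_iff[OF V germ_f[OF u(1)]] by (auto simp: O')
      obtain U \<phi> where U: "(U, \<phi>) \<in> atlas N" "u 0 \<in> U"
        using charted_obtain[OF N frame_germ_value[OF u(1)]] by blast
      \<comment> \<open>The filter of all germs based in \<open>U\<close> whose jets in the chart
        approach the jet of \<open>u\<close>. Convergence along it holds by construction; unfolding
        an eventual statement along it yields one open set \<open>Q'\<close> of jets, that is, a
        basic neighbourhood of \<open>p\<close>.\<close>
      define F where "F = inf (filtercomap (\<lambda>w. jet0 k (\<phi> \<circ> w)) (nhds (jet0 k (\<phi> \<circ> u))))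
        (principal {w. frame_germ k N w \<and> w 0 \<in> U})"
      have F: "\<forall>\<^sub>F w in F. frame_germ k N w \<and> w 0 \<in> U"
        unfolding F_def eventually_inf_principal by (rule always_eventually) auto
      have "((\<lambda>w. jet0 k (\<phi> \<circ> w)) \<longlongrightarrow> jet0 k (\<phi> \<circ> u)) F"
        unfolding F_def by (rule tendsto_mono[OF inf_le1 filterlim_filtercomap])
      then have lim: "jets_tendsto k (\<lambda>w. \<phi> \<circ> w) (\<phi> \<circ> u) F"
        by (rule tendsto_jet0_imp_jets_tendsto)
      note lim' = jets_tendsto_frame[OF N M map U(1) V F u(1) U(2) fu(1) lim]
      have "\<forall>\<^sub>F w in F. f (w 0) \<in> V \<and> jet0 k (\<psi> \<circ> (f \<circ> w)) \<in> Q"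
        using lim'(2) jets_tendsto_imp_tendsto_jet0[OF lim'(1) Q fu(2)] by (rule eventually_conj)
      then obtain Q' where Q': "open Q'" "jet0 k (\<phi> \<circ> u) \<in> Q'"
        "\<And>w. jet0 k (\<phi> \<circ> w) \<in> Q' \<Longrightarrow> frame_germ k N w \<Longrightarrow> w 0 \<in> U \<Longrightarrow>
          f (w 0) \<in> V \<and> jet0 k (\<psi> \<circ> (f \<circ> w)) \<in> Q"
        unfolding F_def eventually_inf_principal eventually_filtercomap eventually_nhds by blast
      have open_B: "openin (frame_topology k N) (frame_basic_open k N U \<phi> Q')"
        unfolding frame_topology_eq by (rule topology_generated_by_Basis) (use U(1) Q'(1) in blast)
      have "frame_basic_open k N U \<phi> Q' \<subseteq> frame_map k M f -` O'"
      proof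
        fix q assume "q \<in> frame_basic_open k N U \<phi> Q'"
        then obtain w where w: "q = frame_jet k N w" "frame_germ k N w" "w 0 \<in> U" "jet0 k (\<phi> \<circ> w) \<in> Q'"
          unfolding frame_basic_open_def by blast
        with Q'(3) show "q \<in> frame_map k M f -` O'"
          using fm[OF w(2)] frame_jet_in_basic_open_iff[OF V germ_f[OF w(2)]] by (simp add: O')
      qed
      moreover have "p \<in> frame_basic_open k N U \<phi> Q'"
        using frame_jet_in_basic_open_iff[OF U(1) u(1)] U(2) Q'(2) u(2) by simp
      ultimately show "\<exists>T. openin (frame_topology k N) T \<and> p \<in> T \<and>
          T \<subseteq> frame_map k M f -` O' \<inter> topspace (frame_topology k N)"
        using open_B openin_subset[OF open_B] by blast
    qed
  qed
qed

section \<open>Diffeomorphisms preserving the orbits\<close>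

text \<open>Each difference of a member of the cover and its interior is closed with empty interior.
  An open set missing all the interiors would be covered by countably many such differences, against
  Baire.\<close>

lemma countable_closed_cover_interior:
  assumes X: "locally_compact_space X" "regular_space X"
    and \<C>: "countable \<C>" "\<And>C. C \<in> \<C> \<Longrightarrow> closedin X C" "topspace X \<subseteq> \<Union>\<C>"
    and T: "openin X T" "T \<noteq> {}"
  shows "\<exists>C\<in>\<C>. T \<inter> X interior_of C \<noteq> {}"
proof (rule ccontr)
  assume neg: "\<not> (\<exists>C\<in>\<C>. T \<inter> X interior_of C \<noteq> {})"
  let ?\<G> = "(\<lambda>C. C - X interior_of C) ` \<C>"
  have "X interior_of \<Union>?\<G> = {}"
  proof (rule Baire_category_alt)
    show "completely_metrizable_space X \<or> locally_compact_space X \<and> regular_space X"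
      using X by simp
    show "countable ?\<G>" using \<C>(1) by (rule countable_image)
    fix D assume "D \<in> ?\<G>"
    then obtain C where C: "C \<in> \<C>" "D = C - X interior_of C" by auto
    have "X interior_of D \<subseteq> X interior_of C \<inter> D"
      using C(2) interior_of_mono[of D C X] interior_of_subset[of X D] by blast
    then have "X interior_of D = {}" using C(2) by blast
    moreover have "closedin X D"
      unfolding C(2) by (intro closedin_diff \<C>(2) C(1) openin_interior_of)
    ultimately show "closedin X D \<and> X interior_of D = {}" by simp
  qed
  moreover have "T \<subseteq> \<Union>?\<G>"
  proof
    fix x assume "x \<in> T"
    then obtain C where "C \<in> \<C>" "x \<in> C" using \<C>(3) openin_subset[OF T(1)] by blast
    with neg \<open>x \<in> T\<close> show "x \<in> \<Union>?\<G>" by blast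
  qed
  then have "T \<subseteq> X interior_of \<Union>?\<G>"
    using T(1) by (rule interior_of_maximal)
  ultimately show False using T(2) by simp
qed

lemma gs_map_orbit_preserving:
  assumes M: "smooth_manifold M" "compact_space (mtop M)"
    and \<Gamma>: "countable (carrier \<Gamma>)" "Ck_action k M \<Gamma> \<alpha>"
    and \<omega>: "geometric_structure M \<omega>" "gs_order \<omega> = k" "action_preserves M \<Gamma> \<alpha> \<omega>"
    and h: "Ck_diffeo k M M h" "\<And>x. x \<in> topspace (mtop M) \<Longrightarrow> h x \<in> orbit \<Gamma> \<alpha> x"
    and w: "frame_germ k M w"
  shows "gs_map \<omega> (frame_jet k M (h \<circ> w)) = gs_map \<omega> (frame_jet k M w)"
proof -
  have ch: "charted M" using M(1) by (rule smooth_manifold_charted)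
  have Haus: "Hausdorff_space (mtop M)" using M(1) by (simp add: smooth_manifold_def)
  have \<alpha>: "Ck_map k M M (\<alpha> \<gamma>)" if "\<gamma> \<in> carrier \<Gamma>" for \<gamma>
    using \<Gamma>(2) that by (simp add: Ck_action_def Ck_diffeo_def)
  have hmap: "Ck_map k M M h" using h(1) by (simp add: Ck_diffeo_def)
  have V: "Hausdorff_space (mtop (gs_space \<omega>))"
    and cont: "continuous_map (frame_topology k M) (mtop (gs_space \<omega>)) (gs_map \<omega>)"
    using \<omega>(1,2) by (auto simp: geometric_structure_def Let_def jet_group_space_def smooth_manifold_def)
  define C where "C \<gamma> = {x \<in> topspace (mtop M). h x = \<alpha> \<gamma> x}" for \<gamma>
  define G where "G = (\<Union>\<gamma>\<in>carrier \<Gamma>. mtop M interior_of C \<gamma>)"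
  have dense: "T \<inter> G \<noteq> {}" if "openin (mtop M) T" "T \<noteq> {}" for T
  proof -
    have "\<exists>C'\<in>C ` carrier \<Gamma>. T \<inter> mtop M interior_of C' \<noteq> {}"
    proof (rule countable_closed_cover_interior[OF _ _ _ _ _ that])
      show "closedin (mtop M) C'" if "C' \<in> C ` carrier \<Gamma>" for C'
        using that Haus hmap \<alpha>
        by (auto simp: C_def Ck_map_def intro!: closedin_continuous_maps_eq)
      show "topspace (mtop M) \<subseteq> \<Union> (C ` carrier \<Gamma>)"
        using h(2) by (auto simp: C_def orbit_def)
    qed (simp_all add: \<Gamma>(1) M(2) Haus compact_imp_locally_compact_space compact_Hausdorff_imp_regular_space)
    then show ?thesis by (auto simp: G_def)
  qed
  have eq_near: "gs_map \<omega> (frame_jet k M (h \<circ> v)) = gs_map \<omega> (frame_jet k M v)"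
    if v: "frame_germ k M v" "v 0 \<in> G" for v
  proof -
    obtain \<gamma> where \<gamma>: "\<gamma> \<in> carrier \<Gamma>" "v 0 \<in> mtop M interior_of C \<gamma>"
      using v(2) by (auto simp: G_def)
    \<comment> \<open>The whole germ of \<open>v\<close> stays in the interior, not only its base
      point; this makes \<open>h \<circ> v\<close> and \<open>\<alpha> \<gamma> \<circ> v\<close>
      agree near 0 and define the same frame.\<close>
    have "\<forall>\<^sub>F x in nhds 0. v x \<in> mtop M interior_of C \<gamma>"
    proof -
      obtain S where S: "0 \<in> S" "frame_germ_on k M S v" using v(1) by (auto simp: frame_germ_iff)
      from S(2) have "continuous_map (top_of_set S) (mtop M) v"
        by (rule frame_germ_onE)
          (auto simp: Ck_diffeo_def Ck_map_def euclid_def open_submfd_def continuous_map_in_subtopology)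
      then have "openin (top_of_set S) {x \<in> S. v x \<in> mtop M interior_of C \<gamma>}"
        using openin_continuous_map_preimage[OF _ openin_interior_of] by fastforce
      moreover have "open S" using S(2) by (simp add: frame_germ_on_def)
      ultimately have "open {x \<in> S. v x \<in> mtop M interior_of C \<gamma>}"
        using openin_open_trans by blast
      then show ?thesis
        using S(1) \<gamma>(2) unfolding eventually_nhds by blast
    qed
    then have "\<forall>\<^sub>F x in nhds 0. (h \<circ> v) x = (\<alpha> \<gamma> \<circ> v) x"
      by eventually_elim (use interior_of_subset[of "mtop M" "C \<gamma>"] in \<open>auto simp: C_def\<close>)
    then have "frame_jet k M (h \<circ> v) = frame_jet k M (\<alpha> \<gamma> \<circ> v)"
      by (rule frame_jet_eventually_eq)
    also have "\<dots> = frame_map k M (\<alpha> \<gamma>) (frame_jet k M v)"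
      by (rule frame_map_frame_jet[OF ch ch \<alpha>[OF \<gamma>(1)] v(1), symmetric])
    finally show ?thesis
      using \<omega>(2,3) \<gamma>(1) v(1) by (auto simp: action_preserves_def preserves_def frame_bundle_def)
  qed
  obtain S where S: "0 \<in> S" "frame_germ_on k M S w" using w by (auto simp: frame_germ_iff)
  have "open S" using S(2) by (simp add: frame_germ_on_def)
  \<comment> \<open>Shifts tending to 0 whose base point \<open>w s\<close> lies in
    \<open>G\<close>, so that the translated frames fall under \<open>eq_near\<close>. Uniqueness of
    limits along this filter requires it to be proper.\<close>
  define F where "F = inf (nhds 0) (principal {s \<in> S. w s \<in> G})"
  have "F \<noteq> bot"
  proof
    assume "F = bot"
    then have "\<forall>\<^sub>F s in nhds 0. s \<notin> {s \<in> S. w s \<in> G}"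
      unfolding F_def by (simp add: trivial_limit_def eventually_inf_principal)
    then obtain T where T: "open T" "0 \<in> T" "\<And>s. s \<in> T \<Longrightarrow> s \<in> S \<Longrightarrow> w s \<notin> G"
      unfolding eventually_nhds by auto
    \<comment> \<open>A representative of a frame is an open map, so the image of every
      neighbourhood of 0 meets the dense set \<open>G\<close>.\<close>
    have "openin (mtop M) (w ` (T \<inter> S))"
      using T(1) \<open>open S\<close> by (intro frame_germ_on_open_image[OF ch S(2)]) auto
    from dense[OF this] T S(1) show False by blast
  qed
  \<comment> \<open>Stated for every germ with domain \<open>S\<close> because both \<open>w\<close>
    and \<open>h \<circ> w\<close> need it.\<close>
  have limF: "limitin (mtop (gs_space \<omega>)) (\<lambda>s. gs_map \<omega> (frame_jet k M (\<lambda>x. v (x + s))))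
      (gs_map \<omega> (frame_jet k M v)) F" if "frame_germ_on k M S v" for v
  proof -
    have "limitin (mtop (gs_space \<omega>)) (gs_map \<omega> \<circ> (\<lambda>s. frame_jet k M (\<lambda>x. v (x + s))))
      (gs_map \<omega> (frame_jet k M v)) (nhds 0)"
      by (rule continuous_map_limit[OF cont limitin_frame_jet_shift[OF ch that S(1)]])
    then show ?thesis
      unfolding limitin_def F_def by (auto simp: o_def intro: filter_leD[OF inf_le1])
  qed
  have lim_h: "limitin (mtop (gs_space \<omega>)) (\<lambda>s. gs_map \<omega> (frame_jet k M (\<lambda>x. (h \<circ> w) (x + s))))
      (gs_map \<omega> (frame_jet k M (h \<circ> w))) F"
    by (rule limF[OF frame_germ_on_compose_left[OF ch ch h(1) S(2)]])
  have "\<forall>\<^sub>F s in F. gs_map \<omega> (frame_jet k M (\<lambda>x. (h \<circ> w) (x + s)))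
      = gs_map \<omega> (frame_jet k M (\<lambda>x. w (x + s)))"
    unfolding F_def eventually_inf_principal
  proof (rule always_eventually, intro allI impI)
    fix s assume s: "s \<in> {s \<in> S. w s \<in> G}"
    then have "frame_germ k M (\<lambda>x. w (x + s))"
      by (intro frame_germ_shift[OF ch S(2)]) auto
    from eq_near[OF this] s show "gs_map \<omega> (frame_jet k M (\<lambda>x. (h \<circ> w) (x + s)))
      = gs_map \<omega> (frame_jet k M (\<lambda>x. w (x + s)))"
      by (simp add: o_def)
  qed
  from limitin_transform_eventually[OF this lim_h] limF[OF S(2)] \<open>F \<noteq> bot\<close> V
  show ?thesis by (rule limitin_Hausdorff_unique)
qed

section \<open>Pullback of a geometric structure and the conclusion\<close>

lemma Ck_diffeo_id:
  assumes "smooth_manifold V"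
  shows "Ck_diffeo k V V id"
proof -
  have ch: "charted V" using assms by (rule smooth_manifold_charted)
  have id: "Ck_map k V V id"
  proof (rule Ck_mapI)
    fix U \<phi> W \<psi> assume "(U, \<phi>) \<in> atlas V" "(W, \<psi>) \<in> atlas V"
    \<comment> \<open>Read in two charts the identity is a transition map, so this is the smooth
      compatibility of the atlas.\<close>
    then have "smooth_on (\<phi> ` (U \<inter> W)) (\<psi> \<circ> inv_into U \<phi>)"
      using assms unfolding smooth_manifold_def by fast
    then show "Ck_on k (\<phi> ` (U \<inter> id -` W)) (\<psi> \<circ> id \<circ> inv_into U \<phi>)"
      by (simp add: smooth_on_def)
  qed simp
  have "Ck_map k V V (inv_into (topspace (mtop V)) id)"
    by (rule Ck_map_cong[OF ch ch id]) (simp add: inv_into_f_eq)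
  with id show ?thesis by (simp add: Ck_diffeo_def)
qed

definition pullback_structure ::
  "('m, 'e::finite_dim_inner) mfd \<Rightarrow> ('n \<Rightarrow> 'm) \<Rightarrow> ('m, 'e, 'v, 'f) geom_structure \<Rightarrow>
   ('n, 'e, 'v, 'f) geom_structure" where
  "pullback_structure M f \<omega> = \<lparr>gs_order = gs_order \<omega>, gs_space = gs_space \<omega>, gs_act = gs_act \<omega>,
     gs_map = (\<lambda>p. gs_map \<omega> (frame_map (gs_order \<omega>) M f p))\<rparr>"

lemma pullback_structure_simps [simp]:
  "gs_order (pullback_structure M f \<omega>) = gs_order \<omega>"
  "gs_space (pullback_structure M f \<omega>) = gs_space \<omega>"
  "gs_act (pullback_structure M f \<omega>) = gs_act \<omega>"
  "gs_map (pullback_structure M f \<omega>) = gs_map \<omega> \<circ> frame_map (gs_order \<omega>) M f"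
  by (simp_all add: pullback_structure_def o_def)

text \<open>Continuity comes from that of the induced map on frames. Equivariance is associativity
  of composition: \<open>f \<circ> (u \<circ> a)\<close> is the frame \<open>f \<circ> u\<close> of
  \<open>M\<close> moved by \<open>a\<close>.\<close>

lemma geometric_structure_pullback:
  assumes N: "charted N" and M: "charted M" and f: "Ck_diffeo (gs_order \<omega>) N M f"
    and \<omega>: "geometric_structure M \<omega>"
  shows "geometric_structure N (pullback_structure M f \<omega>)"
proof -
  have fm: "frame_map (gs_order \<omega>) M f (frame_jet (gs_order \<omega>) N u) = frame_jet (gs_order \<omega>) M (f \<circ> u)"
    if "frame_germ (gs_order \<omega>) N u" for u
    using frame_map_frame_jet[OF N M _ that] f by (simp add: Ck_diffeo_def)
  have "continuous_map (frame_topology (gs_order \<omega>) N) (mtop (gs_space \<omega>))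
      (gs_map \<omega> \<circ> frame_map (gs_order \<omega>) M f)"
    using \<omega> by (intro continuous_map_compose[OF continuous_map_frame_map[OF N M f]])
      (simp add: geometric_structure_def Let_def)
  moreover have "gs_map \<omega> (frame_jet (gs_order \<omega>) M (f \<circ> (u \<circ> a))) =
      gs_act \<omega> (inv\<^bsub>jet_group (gs_order \<omega>)\<^esub> (jet0 (gs_order \<omega>) a))
        (gs_map \<omega> (frame_jet (gs_order \<omega>) M (f \<circ> u)))"
    if "frame_germ (gs_order \<omega>) N u" "a \<in> origin_diffeos" for u a
    using \<omega> frame_germ_compose_left[OF N M f that(1)] that(2)
    by (simp add: geometric_structure_def Let_def flip: comp_assoc)
  ultimately show ?thesis
    using \<omega> fm frame_germ_compose_right[OF N]
    by (simp add: geometric_structure_def Let_def)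
qed

text \<open>The model manifold and the action on it are unchanged, so the identity is an isomorphism
  of jet group spaces.\<close>

lemma same_type_pullback:
  assumes "geometric_structure M \<omega>"
  shows "same_type \<omega> (pullback_structure M f \<omega>)"
proof -
  have "smooth_diffeo (gs_space \<omega>) (gs_space \<omega>) id"
    using assms Ck_diffeo_id
    by (auto simp: smooth_diffeo_def geometric_structure_def jet_group_space_def Let_def)
  then show ?thesis by (auto simp: same_type_def intro!: exI[of _ id])
qed

theorem corollary2p3:
  fixes M :: "('m, 'e::finite_dim_inner) mfd"
    and N :: "('n, 'e) mfd"
    and \<Gamma> :: "('g, 'x) monoid_scheme" and \<alpha> :: "'g \<Rightarrow> 'm \<Rightarrow> 'm"
    and \<Gamma>' :: "('h, 'y) monoid_scheme" and \<alpha>' :: "'h \<Rightarrow> 'n \<Rightarrow> 'n"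
    and \<omega> :: "('m, 'e, 'v, 'f::finite_dim_inner) geom_structure"
    and k :: nat
  assumes "smooth_manifold M" and "compact_space (mtop M)"
    and "countable (carrier \<Gamma>)" and "Ck_action k M \<Gamma> \<alpha>"
    and "geometric_structure M \<omega>" and "gs_order \<omega> = k" and "action_preserves M \<Gamma> \<alpha> \<omega>"
    and "smooth_manifold N" and "Ck_action k N \<Gamma>' \<alpha>'"
    and "Ck_orbit_equivalent k N \<Gamma>' \<alpha>' M \<Gamma> \<alpha>"
  shows "\<exists>\<omega>' :: ('n, 'e, 'v, 'f) geom_structure.
           geometric_structure N \<omega>' \<and> same_type \<omega> \<omega>' \<and> action_preserves N \<Gamma>' \<alpha>' \<omega>'"
proof -
  note N = smooth_manifold_charted[OF assms(8)] and M = smooth_manifold_charted[OF assms(1)]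
  obtain f where f: "Ck_diffeo k N M f"
    and orb: "\<And>x y. x \<in> topspace (mtop N) \<Longrightarrow> y \<in> topspace (mtop N) \<Longrightarrow>
      y \<in> orbit \<Gamma>' \<alpha>' x \<longleftrightarrow> f y \<in> orbit \<Gamma> \<alpha> (f x)"
    using assms(10) by (auto simp: Ck_orbit_equivalent_def)
  let ?f' = "inv_into (topspace (mtop N)) f"
  have bij: "bij_betw f (topspace (mtop N)) (topspace (mtop M))"
    using f by (simp add: Ck_diffeo_def)
  have "preserves N (pullback_structure M f \<omega>) (\<alpha>' \<gamma>)" if \<gamma>: "\<gamma> \<in> carrier \<Gamma>'" for \<gamma>
    unfolding preserves_def
  proof
    fix p assume "p \<in> frame_bundle (gs_order (pullback_structure M f \<omega>)) N"
    then obtain u where u: "frame_germ k N u" "p = frame_jet k N u"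
      by (auto simp: frame_bundle_def assms(6))
    have g: "Ck_diffeo k N N (\<alpha>' \<gamma>)"
      using assms(9) \<gamma> by (simp add: Ck_action_def)
    define h where "h = f \<circ> (\<alpha>' \<gamma> \<circ> ?f')"
    have h: "Ck_diffeo k M M h"
      unfolding h_def
      by (rule Ck_diffeo_compose[OF M N M Ck_diffeo_compose[OF M N N Ck_diffeo_inverse[OF N M f] g] f])
    have h_orb: "h x \<in> orbit \<Gamma> \<alpha> x" if "x \<in> topspace (mtop M)" for x
    proof -
      have y: "?f' x \<in> topspace (mtop N)" "f (?f' x) = x"
        using bij that by (metis bij_betw_def inv_into_into, metis bij_betw_inv_into_right)
      moreover have "\<alpha>' \<gamma> (?f' x) \<in> topspace (mtop N)"
        using g y(1) by (auto simp: Ck_diffeo_def dest: bij_betwE)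
      moreover have "\<alpha>' \<gamma> (?f' x) \<in> orbit \<Gamma>' \<alpha>' (?f' x)"
        using \<gamma> by (auto simp: orbit_def)
      ultimately show ?thesis using orb by (simp add: h_def)
    qed
    obtain S where S: "0 \<in> S" "frame_germ_on k N S u" using u(1) by (auto simp: frame_germ_iff)
    have "\<forall>\<^sub>F x in nhds 0. x \<in> S"
      using S by (intro eventually_nhds_in_open) (auto simp: frame_germ_on_def)
    \<comment> \<open>The inverse \<open>?f'\<close> inside \<open>h\<close> cancels
      \<open>f\<close> only at points of \<open>N\<close>, so the two composites agree where
      \<open>u\<close> is a genuine parametrisation, namely on \<open>S\<close>; agreement near 0 is
      enough for equal frames.\<close>
    then have "\<forall>\<^sub>F x in nhds 0. (f \<circ> (\<alpha>' \<gamma> \<circ> u)) x = (h \<circ> (f \<circ> u)) x"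
    proof eventually_elim
      case (elim x)
      then have "u x \<in> topspace (mtop N)"
        using frame_germ_on_image_subset[OF S(2)] by auto
      then show ?case using bij_betw_inv_into_left[OF bij] by (simp add: h_def)
    qed
    then have jet: "frame_jet k M (f \<circ> (\<alpha>' \<gamma> \<circ> u)) = frame_jet k M (h \<circ> (f \<circ> u))"
      by (rule frame_jet_eventually_eq)
    have "gs_map (pullback_structure M f \<omega>) (frame_map k N (\<alpha>' \<gamma>) p)
        = gs_map \<omega> (frame_jet k M (f \<circ> (\<alpha>' \<gamma> \<circ> u)))"
      using f g u(1) frame_germ_compose_left[OF N N g u(1)]
      by (simp add: u(2) assms(6) Ck_diffeo_def frame_map_frame_jet[OF N N] frame_map_frame_jet[OF N M])
    also have "\<dots> = gs_map \<omega> (frame_jet k M (f \<circ> u))"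
      unfolding jet
      by (rule gs_map_orbit_preserving[OF assms(1-7) h h_orb frame_germ_compose_left[OF N M f u(1)]])
    also have "\<dots> = gs_map (pullback_structure M f \<omega>) p"
      using f u(1) by (simp add: u(2) assms(6) Ck_diffeo_def frame_map_frame_jet[OF N M])
    finally show "gs_map (pullback_structure M f \<omega>)
        (frame_map (gs_order (pullback_structure M f \<omega>)) N (\<alpha>' \<gamma>) p) = gs_map (pullback_structure M f \<omega>) p"
      by (simp add: assms(6))
  qed
  then have "action_preserves N \<Gamma>' \<alpha>' (pullback_structure M f \<omega>)"
    by (simp add: action_preserves_def)
  moreover have "geometric_structure N (pullback_structure M f \<omega>)"
    using f assms(5,6) by (intro geometric_structure_pullback N M) auto
  ultimately show ?thesis using same_type_pullback[OF assms(5)] by blast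
qed

end
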